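(* Let $N,s,d\in\mathbb N$, let $k\in\mathbb N$, and let $\mathbf F^{[\nu]}\in\mathcal C^{k+1}(\mathbb R^d,\mathbb R^d)$ be Lipschitz continuous for $\nu=1,\dots,N$. Consider one step, from $\mathbf y^n\in\mathbb R^d$ with step size $h$, of the non-standard additive Runge--Kutta (NSARK) method $$\mathbf y^{(i)}=\mathbf y^n+h\sum_{j=1}^s\sum_{\nu=1}^N a^{[\nu]}_{ij}(\mathbf Y^n,h)\,\mathbf F^{[\nu]}(\mathbf y^{(j)}),\quad i=1,\dots,s,\qquad \mathbf y^{n+1}=\mathbf y^n+h\sum_{j=1}^s\sum_{\nu=1}^N b^{[\nu]}_{j}(\mathbf Y^n,h)\,\mathbf F^{[\nu]}(\mathbf y^{(j)}),$$ where $\mathbf Y^n=(\mathbf y^n,\mathbf y^{(1)},\dots,\mathbf y^{(s)},\mathbf y^{n+1})$. Suppose that for small enough $h$ there exists a solution to the stage equations, and that $a^{[\nu]}_{ij}(\mathbf Y^n,h)=\mathcal O(1)$ and $b^{[\nu]}_{j}(\mathbf Y^n,h)=\mathcal O(1)$ as $h\to0$ for all $i,j=1,\dots,s$ and $\nu=1,\dots,N$. Let $d_i$, $g_i^{[\nu]}$, $u$ be the solution-dependent functions on colored trees defined recursively in the context. Then, as $h\to 0$, $$\mathbf y^{(i)}=\mathbf y^n+\sum_{\tau\in NT_k}\frac{1}{\sigma(\tau)}d_i(\tau,\mathbf Y^n,h)h^{|\tau|}\mathcal F(\tau)(\mathbf y^n)+\mathcal O(h^{k+1}),\quad i=1,\dots,s,$$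 $$h\mathbf F^{[\nu]}(\mathbf y^{(i)})=\sum_{\tau\in NT_k}\frac{1}{\sigma(\tau)}g^{[\nu]}_i(\tau,\mathbf Y^n,h)h^{|\tau|}\mathcal F(\tau)(\mathbf y^n)+\mathcal O(h^{k+1}),\quad i=1,\dots,s,\ \nu=1,\dots,N,$$ $$\mathbf y^{n+1}=\mathbf y^n+\sum_{\tau\in NT_k}\frac{1}{\sigma(\tau)}u(\tau,\mathbf Y^n,h)h^{|\tau|}\mathcal F(\tau)(\mathbf y^n)+\mathcal O(h^{k+1}).$$
   Context: All $\mathcal O$-statements are with respect to $h\to0$ (with $\mathbf y^n$ fixed). The coefficients $a^{[\nu]}_{ij}(\mathbf Y^n,h),b^{[\nu]}_j(\mathbf Y^n,h)\in\mathbb R$ may depend on the solution and the step size; no regularity of them is assumed. Colored trees: $NT$ is the set of rooted trees (children unordered) each of whose nodes carries one of $N$ colors. $\bullet^{[\mu]}$ is the one-node tree of color $\mu$, and $[\tau_1,\dots,\tau_l]^{[\mu]}$ is the tree with root of color $\mu$ and child subtrees $\tau_1,\dots,\tau_l\in NT$. $|\tau|$ is the number of nodes and $NT_q=\{\tau\in NT: |\tau|\le q\}$. If $\tau=[\tau_1^{m_1},\dots,\tau_r^{m_r}]^{[\mu]}$ with pairwise distinct colored trees $\tau_j$ occurring with multiplicities $m_j$, the symmetry is $\sigma(\tau)=\prod_{j=1}^r m_j!\,\sigma(\tau_j)^{m_j}$, with $\sigma(\bullet^{[\mu]})=1$. Elementary differentials: $\mathcal F(\bullet^{[\nu]})(\mathbf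 y)=\mathbf F^{[\nu]}(\mathbf y)$ and $\mathcal F([\tau_1,\dots,\tau_l]^{[\nu]})(\mathbf y)=\sum_{i_1,\dots,i_l=1}^d\partial_{i_1,\dots,i_l}\mathbf F^{[\nu]}(\mathbf y)\,\mathcal F_{i_1}(\tau_1)(\mathbf y)\cdots\mathcal F_{i_l}(\tau_l)(\mathbf y)$, where $\mathcal F_i$ is the $i$-th component. Recursion (with $\delta_{\nu\mu}$ the Kronecker delta, $\nu,\mu=1,\dots,N$, $i=1,\dots,s$): $u(\tau,\mathbf Y^n,h)=\sum_{\nu=1}^N\sum_{i=1}^s b_i^{[\nu]}(\mathbf Y^n,h)\,g_i^{[\nu]}(\tau,\mathbf Y^n,h)$; $g_i^{[\nu]}(\bullet^{[\mu]},\mathbf Y^n,h)=\delta_{\nu\mu}$; $g_i^{[\nu]}([\tau_1,\dots,\tau_l]^{[\mu]},\mathbf Y^n,h)=\delta_{\nu\mu}\prod_{j=1}^l d_i(\tau_j,\mathbf Y^n,h)$; $d_i(\tau,\mathbf Y^n,h)=\sum_{\nu=1}^N\sum_{j=1}^s a_{ij}^{[\nu]}(\mathbf Y^n,h)\,g_j^{[\nu]}(\tau,\mathbf Y^n,h)$. *)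

theory Defs
  imports "HOL-Analysis.Analysis" "HOL-Library.Multiset" "HOL-Library.Landau_Symbols"
begin

section \<open>Colored rooted trees\<close>

text \<open>The children of a node form a multiset, since they are unordered. The set of colors is
  represented by a finite type.\<close>

datatype 'c ctree = Node 'c "'c ctree multiset"

primrec num_nodes :: "'c ctree \<Rightarrow> nat" where
  "num_nodes (Node \<mu> ts) = Suc (sum_mset (image_mset num_nodes ts))"

lemma num_nodes_child: "t \<in># ts \<Longrightarrow> num_nodes t < num_nodes (Node \<mu> ts)"
  by (auto dest!: multi_member_split)

lemma num_nodes_child_double: "t \<in># ts \<Longrightarrow> Suc (2 * num_nodes t) < 2 * num_nodes (Node \<mu> ts)"
  using num_nodes_child[of t ts \<mu>] by linarith

definition NT :: "nat \<Rightarrow> 'c ctree set" where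
  "NT q = {\<tau>. num_nodes \<tau> \<le> q}"

text \<open>Sums over \<open>NT q\<close> are genuine finite sums.\<close>

lemma size_le_sum_num_nodes: "size ts \<le> sum_mset (image_mset num_nodes ts)"
proof (induction ts)
  case (add t ts)
  then show ?case by (cases t) auto
qed simp

lemma finite_NT: "finite (NT q :: 'c::finite ctree set)"
proof (induction q)
  case 0
  have "NT 0 = ({} :: 'c ctree set)"
  proof -
    have "num_nodes \<tau> > 0" for \<tau> :: "'c ctree" by (cases \<tau>) simp
    then show ?thesis by (auto simp: NT_def)
  qed
  then show ?case by simp
next
  case (Suc q)
  let ?L = "{xs :: 'c ctree list. set xs \<subseteq> NT q \<and> length xs \<le> q}"
  have "NT (Suc q) \<subseteq> (\<lambda>(\<mu>, xs). Node \<mu> (mset xs)) ` (UNIV \<times> ?L)"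
  proof
    fix \<tau> :: "'c ctree" assume \<tau>: "\<tau> \<in> NT (Suc q)"
    obtain \<mu> ts where N: "\<tau> = Node \<mu> ts" by (cases \<tau>)
    obtain xs where xs: "mset xs = ts" using ex_mset by blast
    have "sum_mset (image_mset num_nodes ts) \<le> q" using \<tau> N by (simp add: NT_def)
    then have "length xs \<le> q" using size_le_sum_num_nodes[of ts] xs by auto
    moreover have "t \<in> NT q" if "t \<in> set xs" for t
      using num_nodes_child[of t ts \<mu>] that \<tau> N xs by (auto simp: NT_def)
    ultimately show "\<tau> \<in> (\<lambda>(\<mu>, xs). Node \<mu> (mset xs)) ` (UNIV \<times> ?L)"
      using N xs by force
  qed
  moreover have "finite ?L" by (rule finite_lists_length_le[OF Suc.IH])
  ultimately show ?case by (auto intro: finite_subset)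
qed

function symmetry :: "'c ctree \<Rightarrow> nat" where
  "symmetry (Node \<mu> ts) = (\<Prod>t\<in>set_mset ts. fact (count ts t) * symmetry t ^ count ts t)"
  by pat_completeness auto
termination
  by (relation "Wellfounded.measure num_nodes") (auto simp: num_nodes_child simp del: num_nodes.simps)


section \<open>Elementary differentials\<close>

definition partial_deriv ::
  "'d \<Rightarrow> (real ^ 'd \<Rightarrow> real ^ 'd) \<Rightarrow> real ^ 'd \<Rightarrow> real ^ 'd" where
  "partial_deriv i f x = vector_derivative (\<lambda>t. f (x + t *\<^sub>R axis i 1)) (at 0)"

fun partial_derivs ::
  "'d list \<Rightarrow> (real ^ 'd \<Rightarrow> real ^ 'd) \<Rightarrow> real ^ 'd \<Rightarrow> real ^ 'd" where
  "partial_derivs [] f = f"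
| "partial_derivs (i # js) f = partial_deriv i (partial_derivs js f)"

text \<open>\<open>C_diff m f\<close> expresses that \<open>f\<close> belongs to \<open>C\<^sup>m\<close> on the whole space.\<close>

fun C_diff :: "nat \<Rightarrow> (real ^ 'd \<Rightarrow> real ^ 'd) \<Rightarrow> bool" where
  "C_diff 0 f \<longleftrightarrow> continuous_on UNIV f"
| "C_diff (Suc m) f \<longleftrightarrow> (\<forall>x. f differentiable (at x)) \<and> (\<forall>i. C_diff m (partial_deriv i f))"

text \<open>The elementary differential is written with some enumeration of the child subtrees.
  For trees with at most \<open>k\<close> nodes and functions of class \<open>C\<^sup>k\<close> the choice of the
  enumeration is irrelevant, because the partial derivatives involved commute.\<close>

definition listing :: "'a multiset \<Rightarrow> 'a list" where
  "listing M = (SOME xs. mset xs = M)"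

lemma mset_listing [simp]: "mset (listing M) = M"
  unfolding listing_def by (rule someI_ex) (rule ex_mset)

lemma nth_listing_mem: "j < length (listing M) \<Longrightarrow> listing M ! j \<in># M"
  by (metis mset_listing nth_mem_mset)

function elem_diff ::
  "('n \<Rightarrow> real ^ 'd \<Rightarrow> real ^ 'd) \<Rightarrow> 'n ctree \<Rightarrow> real ^ 'd \<Rightarrow> real ^ 'd" where
  "elem_diff F (Node \<nu> ts) y =
    (\<Sum>js | length js = length (listing ts).
      (\<Prod>j<length (listing ts). elem_diff F (listing ts ! j) y $ (js ! j))
        *\<^sub>R partial_derivs js (F \<nu>) y)"
  by pat_completeness auto
termination
  by (relation "Wellfounded.measure (\<lambda>(F, \<tau>, y). num_nodes \<tau>)")
     (auto intro!: num_nodes_child nth_listing_mem simp del: num_nodes.simps)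

lemma listing_empty [simp]: "listing {#} = []"
  by (metis mset_listing mset_zero_iff)

lemma elem_diff_leaf: "elem_diff F (Node \<nu> {#}) y = F \<nu> y"
  by simp


section \<open>Non-standard additive Runge--Kutta methods\<close>

text \<open>A value of type \<open>('d, 's) stages\<close> is a tuple
  \<open>(y\<^sup>n, (y\<^sup>(\<^sup>i\<^sup>))\<^sub>i, y\<^sup>n\<^sup>+\<^sup>1)\<close>; stage indices range over the
  finite type \<open>'s\<close> and the colors (addends) over the finite type \<open>'n\<close>. The coefficient
  \<open>a \<nu> i j Y h\<close> stands for \<open>a\<^sub>i\<^sub>j\<^sup>[\<^sup>\<nu>\<^sup>](Y, h)\<close>, and \<open>b \<nu> j Y h\<close>
  for \<open>b\<^sub>j\<^sup>[\<^sup>\<nu>\<^sup>](Y, h)\<close>.\<close>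

type_synonym ('d, 's) stages = "(real ^ 'd) \<times> ('s \<Rightarrow> real ^ 'd) \<times> (real ^ 'd)"

definition nsark_step ::
  "('n::finite \<Rightarrow> 's::finite \<Rightarrow> 's \<Rightarrow> ('d, 's) stages \<Rightarrow> real \<Rightarrow> real) \<Rightarrow>
   ('n \<Rightarrow> 's \<Rightarrow> ('d, 's) stages \<Rightarrow> real \<Rightarrow> real) \<Rightarrow>
   ('n \<Rightarrow> real ^ 'd \<Rightarrow> real ^ 'd) \<Rightarrow> real \<Rightarrow> ('d::finite, 's) stages \<Rightarrow> bool" where
  "nsark_step a b F h Y \<longleftrightarrow> (case Y of (y0, ys, y1) \<Rightarrow>
     (\<forall>i. ys i = y0 + h *\<^sub>R (\<Sum>j\<in>UNIV. \<Sum>\<nu>\<in>UNIV. a \<nu> i j Y h *\<^sub>R F \<nu> (ys j))) \<and>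
     y1 = y0 + h *\<^sub>R (\<Sum>j\<in>UNIV. \<Sum>\<nu>\<in>UNIV. b \<nu> j Y h *\<^sub>R F \<nu> (ys j)))"

declare image_mset_cong [fundef_cong]

function
  nsark_g :: "('n::finite \<Rightarrow> 's::finite \<Rightarrow> 's \<Rightarrow> ('d, 's) stages \<Rightarrow> real \<Rightarrow> real) \<Rightarrow>
     'n \<Rightarrow> 's \<Rightarrow> 'n ctree \<Rightarrow> ('d::finite, 's) stages \<Rightarrow> real \<Rightarrow> real" and
  nsark_d :: "('n::finite \<Rightarrow> 's::finite \<Rightarrow> 's \<Rightarrow> ('d, 's) stages \<Rightarrow> real \<Rightarrow> real) \<Rightarrow>
     's \<Rightarrow> 'n ctree \<Rightarrow> ('d::finite, 's) stages \<Rightarrow> real \<Rightarrow> real" where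
  "nsark_g a \<nu> i (Node \<mu> ts) Y h =
     (if \<nu> = \<mu> then 1 else 0) * prod_mset (image_mset (\<lambda>t. nsark_d a i t Y h) ts)"
| "nsark_d a i \<tau> Y h = (\<Sum>\<nu>\<in>UNIV. \<Sum>j\<in>UNIV. a \<nu> i j Y h * nsark_g a \<nu> j \<tau> Y h)"
  by pat_completeness auto
termination
  by (relation "Wellfounded.measure (case_sum (\<lambda>(a, \<nu>, i, \<tau>, Y, h). 2 * num_nodes \<tau>)
                                  (\<lambda>(a, i, \<tau>, Y, h). 2 * num_nodes \<tau> + 1))")
     (auto intro: num_nodes_child_double simp del: num_nodes.simps)

text \<open>The recursion equation for \<open>nsark_d\<close> would be applied too eagerly by the simplifier.\<close>

declare nsark_d.simps [simp del]

definition nsark_u ::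
  "('n::finite \<Rightarrow> 's::finite \<Rightarrow> 's \<Rightarrow> ('d, 's) stages \<Rightarrow> real \<Rightarrow> real) \<Rightarrow>
   ('n \<Rightarrow> 's \<Rightarrow> ('d, 's) stages \<Rightarrow> real \<Rightarrow> real) \<Rightarrow>
   'n ctree \<Rightarrow> ('d::finite, 's) stages \<Rightarrow> real \<Rightarrow> real" where
  "nsark_u a b \<tau> Y h = (\<Sum>\<nu>\<in>UNIV. \<Sum>i\<in>UNIV. b \<nu> i Y h * nsark_g a \<nu> i \<tau> Y h)"

end

theory Submission
  imports Defs "HOL-Combinatorics.Multiset_Permutations"
begin

text \<open>The expansions of the stages and of \<open>h F\<^sup>[\<^sup>\<nu>\<^sup>]\<close> at the stages are proved together by induction
  on the order. The Lipschitz condition keeps the stages bounded, which gives order zero. Since the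
  coefficients are bounded, an expansion of all \<open>h F\<^sup>[\<^sup>\<nu>\<^sup>](y\<^sup>(\<^sup>j\<^sup>))\<close> yields one of the same order for
  the stages by linear combination. Conversely, a stage expansion is inserted into the Taylor
  polynomial of \<open>F\<^sup>[\<^sup>\<nu>\<^sup>]\<close>, and the factor \<open>h\<close> gains one order. Expanding the multilinear terms gives
  a sum over lists of trees; since partial derivatives commute, its terms depend only on the
  multiset of the trees, and the number of lists with a given multiset turns \<open>1 / m!\<close> into the
  symmetry factors.\<close>

section \<open>Smooth vector fields and Taylor expansion\<close>

text \<open>Since \<open>partial_deriv\<close> is a one-dimensional derivative, it first has to be
  identified with the value of the Frechet derivative at a basis vector. Linearity then gives every
  direction \<open>v\<close>.\<close>

lemma has_vector_derivative_along_line: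
  fixes f :: "real ^ 'd::finite \<Rightarrow> real ^ 'd"
  assumes "\<And>x. f differentiable (at x)"
  shows "((\<lambda>t. f (x + t *\<^sub>R v)) has_vector_derivative
           (\<Sum>j\<in>UNIV. v $ j *\<^sub>R partial_deriv j f (x + t *\<^sub>R v))) (at t)"
proof -
  let ?D = "frechet_derivative f (at (x + t *\<^sub>R v))"
  have D: "(f has_derivative ?D) (at (x + t *\<^sub>R v))"
    using assms frechet_derivative_works by blast
  \<comment> \<open>Any line through the base point is allowed, because two are needed: one along a
    coordinate axis, passed at parameter 0, and the given one along \<open>v\<close>, passed at
    parameter \<open>t\<close>.\<close>
  have line: "((\<lambda>s. f (y + s *\<^sub>R w)) has_vector_derivative ?D w) (at s)"
    if "y + s *\<^sub>R w = x + t *\<^sub>R v" for y s w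
  proof -
    have "((\<lambda>s. y + s *\<^sub>R w) has_vector_derivative w) (at s)"
      by (auto intro!: derivative_eq_intros)
    with D show ?thesis
      using vector_derivative_diff_chain_within[of "\<lambda>s. y + s *\<^sub>R w" w s UNIV f ?D] that
      by (auto simp: o_def intro: has_derivative_at_withinI)
  qed
  have "?D (axis j 1) = partial_deriv j f (x + t *\<^sub>R v)" for j
    unfolding partial_deriv_def
    using vector_derivative_at[OF line[of "x + t *\<^sub>R v" 0 "axis j 1"]] by simp
  moreover have "linear ?D" using D has_derivative_linear by blast
  then have "?D (\<Sum>j\<in>UNIV. v $ j *\<^sub>R axis j 1) = (\<Sum>j\<in>UNIV. v $ j *\<^sub>R ?D (axis j 1))"
    by (simp add: linear_sum linear_cmul)
  moreover have "(\<Sum>j\<in>UNIV. v $ j *\<^sub>R axis j 1) = v"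
    using basis_expansion[of v] by (simp add: scalar_mult_eq_scaleR)
  ultimately show ?thesis using line[of x t v] by simp
qed

lemma has_vector_derivative_along_axis:
  fixes f :: "real ^ 'd::finite \<Rightarrow> real ^ 'd"
  assumes "\<And>x. f differentiable (at x)"
  shows "((\<lambda>t. f (x + t *\<^sub>R axis i 1)) has_vector_derivative
           partial_deriv i f (x + t *\<^sub>R axis i 1)) (at t)"
proof -
  have "(\<Sum>j\<in>UNIV. axis i (1::real) $ j *\<^sub>R partial_deriv j f (x + t *\<^sub>R axis i 1)) =
        (\<Sum>j\<in>UNIV. if j = i then partial_deriv j f (x + t *\<^sub>R axis i 1) else 0)"
    by (intro sum.cong) (auto simp: axis_def)
  then show ?thesis
    using has_vector_derivative_along_line[OF assms, of x "axis i 1" t] by simp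
qed

lemma C_diff_imp_continuous: "C_diff m f \<Longrightarrow> continuous_on UNIV (f :: real ^ 'd::finite \<Rightarrow> _)"
  by (cases m) (auto intro!: differentiable_imp_continuous_on simp: differentiable_on_def)

lemma C_diff_Suc_imp: "C_diff (Suc m) f \<Longrightarrow> C_diff m (f :: real ^ 'd::finite \<Rightarrow> _)"
proof (induction m arbitrary: f)
  case 0
  then show ?case by (metis C_diff.simps(1) C_diff_imp_continuous)
next
  case (Suc m)
  then show ?case by (metis C_diff.simps(2))
qed

lemma C_diff_mono: "C_diff m f \<Longrightarrow> n \<le> m \<Longrightarrow> C_diff n (f :: real ^ 'd::finite \<Rightarrow> _)"
  by (induction m) (auto simp: le_Suc_eq simp del: C_diff.simps dest: C_diff_Suc_imp)

lemma C_diff_partial_derivs: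
  "C_diff (length js + m) f \<Longrightarrow> C_diff m (partial_derivs js (f :: real ^ 'd::finite \<Rightarrow> _))"
proof (induction js arbitrary: m)
  case (Cons j js)
  have "C_diff (Suc m) (partial_derivs js f)"
    using Cons by (intro Cons.IH) simp
  then show ?case by simp
qed simp

section \<open>Symmetry of mixed partial derivatives\<close>

text \<open>The mean value theorem is applied twice, first along axis \<open>i\<close> to the
  increment in direction \<open>j\<close>, then along axis \<open>j\<close> to
  \<open>partial_deriv i f\<close>. It is a theorem on real functions, so a single component
  \<open>c\<close> is treated and the intermediate points may depend on it.\<close>

lemma second_difference_mvt:
  fixes f :: "real ^ 'd::finite \<Rightarrow> real ^ 'd"
  assumes "C_diff 2 f" "h > 0"
  obtains s t where "0 < s" "s < h" "0 < t" "t < h"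
    "f (x + h *\<^sub>R axis i 1 + h *\<^sub>R axis j 1) $ c - f (x + h *\<^sub>R axis i 1) $ c
       - f (x + h *\<^sub>R axis j 1) $ c + f x $ c =
     h * h * partial_deriv j (partial_deriv i f) (x + s *\<^sub>R axis i 1 + t *\<^sub>R axis j 1) $ c"
proof -
  have df: "f differentiable (at y)" and ddf: "partial_deriv i f differentiable (at y)" for y
    using assms(1) by (simp_all add: numeral_2_eq_2)
  let ?i = "axis i (1::real) :: real ^ 'd" and ?j = "axis j (1::real) :: real ^ 'd"
  have component: "(g has_vector_derivative g') (at t) \<Longrightarrow>
      ((\<lambda>t. g t $ c) has_real_derivative g' $ c) (at t)" for g :: "real \<Rightarrow> real ^ 'd" and g' t
    using bounded_linear.has_vector_derivative[OF bounded_linear_vec_nth]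
    by (simp add: has_real_derivative_iff_has_vector_derivative)
  have 1: "((\<lambda>s. f (x + s *\<^sub>R ?i + h *\<^sub>R ?j) $ c - f (x + s *\<^sub>R ?i) $ c) has_real_derivative
      partial_deriv i f (x + s *\<^sub>R ?i + h *\<^sub>R ?j) $ c - partial_deriv i f (x + s *\<^sub>R ?i) $ c) (at s)" for s
    using component[OF has_vector_derivative_along_axis[OF df, of "x + h *\<^sub>R ?j" i s]]
      component[OF has_vector_derivative_along_axis[OF df, of x i s]]
    by (intro DERIV_diff) (simp_all add: add_ac)
  obtain s where s: "0 < s" "s < h"
    "f (x + h *\<^sub>R ?i + h *\<^sub>R ?j) $ c - f (x + h *\<^sub>R ?i) $ c - (f (x + h *\<^sub>R ?j) $ c - f x $ c)
     = h * (partial_deriv i f (x + s *\<^sub>R ?i + h *\<^sub>R ?j) $ c - partial_deriv i f (x + s *\<^sub>R ?i) $ c)"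
    using MVT2[OF assms(2), OF 1] by auto
  have 2: "((\<lambda>t. partial_deriv i f (x + s *\<^sub>R ?i + t *\<^sub>R ?j) $ c) has_real_derivative
      partial_deriv j (partial_deriv i f) (x + s *\<^sub>R ?i + t *\<^sub>R ?j) $ c) (at t)" for t
    by (intro component has_vector_derivative_along_axis ddf)
  obtain t where t: "0 < t" "t < h"
    "partial_deriv i f (x + s *\<^sub>R ?i + h *\<^sub>R ?j) $ c - partial_deriv i f (x + s *\<^sub>R ?i) $ c
     = h * partial_deriv j (partial_deriv i f) (x + s *\<^sub>R ?i + t *\<^sub>R ?j) $ c"
    using MVT2[OF assms(2), OF 2] by auto
  show thesis using that[OF s(1,2) t(1,2)] s(3) t(3) by simp
qed

text \<open>Schwarz's theorem. The second difference is symmetric in \<open>i\<close> and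
  \<open>j\<close>, so both mixed derivatives attain a common value at points arbitrarily close to
  \<open>x\<close>; continuity carries the equality over to \<open>x\<close>.\<close>

lemma partial_deriv_commute:
  fixes f :: "real ^ 'd::finite \<Rightarrow> real ^ 'd"
  assumes "C_diff 2 f"
  shows "partial_deriv i (partial_deriv j f) = partial_deriv j (partial_deriv i f)"
proof (intro ext, subst vec_eq_iff, intro allI)
  fix x c
  let ?p = "\<lambda>y. partial_deriv i (partial_deriv j f) y $ c"
  let ?q = "\<lambda>y. partial_deriv j (partial_deriv i f) y $ c"
  \<comment> \<open>Each intermediate point is shifted by less than \<open>h\<close> along two axes,
    hence the radius \<open>2 * h\<close>.\<close>
  have near: "\<exists>y z. ?p y = ?q z \<and> dist y x < 2 * h \<and> dist z x < 2 * h" if h: "h > 0" for h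
  proof -
    have close: "dist (x + s *\<^sub>R axis k 1 + t *\<^sub>R axis l 1) x < 2 * h"
      if "0 < s" "s < h" "0 < t" "t < h" for s t :: real and k l
    proof -
      have "norm (s *\<^sub>R axis k 1 + t *\<^sub>R axis l (1::real) :: real ^ 'd) \<le> \<bar>s\<bar> + \<bar>t\<bar>"
        using norm_triangle_ineq[of "s *\<^sub>R axis k 1" "t *\<^sub>R axis l (1::real) :: real ^ 'd"]
        by simp
      then show ?thesis using that by (simp add: dist_norm add.assoc)
    qed
    obtain s t where st: "0 < s" "s < h" "0 < t" "t < h"
      "f (x + h *\<^sub>R axis i 1 + h *\<^sub>R axis j 1) $ c - f (x + h *\<^sub>R axis i 1) $ c
       - f (x + h *\<^sub>R axis j 1) $ c + f x $ c = h * h * ?q (x + s *\<^sub>R axis i 1 + t *\<^sub>R axis j 1)"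
      using second_difference_mvt[OF assms h] by metis
    obtain s' t' where st': "0 < s'" "s' < h" "0 < t'" "t' < h"
      "f (x + h *\<^sub>R axis j 1 + h *\<^sub>R axis i 1) $ c - f (x + h *\<^sub>R axis j 1) $ c
       - f (x + h *\<^sub>R axis i 1) $ c + f x $ c = h * h * ?p (x + s' *\<^sub>R axis j 1 + t' *\<^sub>R axis i 1)"
      using second_difference_mvt[OF assms h] by metis
    have "h * h * ?q (x + s *\<^sub>R axis i 1 + t *\<^sub>R axis j 1) =
          h * h * ?p (x + s' *\<^sub>R axis j 1 + t' *\<^sub>R axis i 1)"
      unfolding st(5)[symmetric] st'(5)[symmetric] by (simp add: add_ac)
    then have "?p (x + s' *\<^sub>R axis j 1 + t' *\<^sub>R axis i 1) =
          ?q (x + s *\<^sub>R axis i 1 + t *\<^sub>R axis j 1)" using h by simp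
    then show ?thesis using close[OF st(1-4)] close[OF st'(1-4)] by blast
  qed
  have "continuous_on UNIV ?p" "continuous_on UNIV ?q"
    using assms by (auto simp: numeral_2_eq_2 intro: continuous_on_component)
  then have cont: "isCont ?p x" "isCont ?q x"
    by (simp_all add: continuous_on_eq_continuous_at)
  show "?p x = ?q x"
  proof (rule ccontr)
    assume "?p x \<noteq> ?q x"
    \<comment> \<open>Half the gap suffices: a common value of \<open>?p\<close> and
      \<open>?q\<close> cannot be strictly closer than that to both \<open>?p x\<close> and
      \<open>?q x\<close>.\<close>
    then have e: "\<bar>?p x - ?q x\<bar> / 2 > 0" (is "?e > 0") by simp
    obtain d1 where d1: "d1 > 0" "\<And>y. dist y x < d1 \<Longrightarrow> dist (?p y) (?p x) < ?e"
      using cont(1) e unfolding continuous_at_eps_delta by metis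
    obtain d2 where d2: "d2 > 0" "\<And>y. dist y x < d2 \<Longrightarrow> dist (?q y) (?q x) < ?e"
      using cont(2) e unfolding continuous_at_eps_delta by metis
    obtain y z where "?p y = ?q z" "dist y x < d1" "dist z x < d2"
      using near[of "min d1 d2 / 2"] d1(1) d2(1) by auto
    then show False
      using d1(2)[of y] d2(2)[of z] unfolding dist_real_def by (smt (verit) field_sum_of_halves)
  qed
qed

lemma partial_derivs_append:
  "partial_derivs (is @ js) f = partial_derivs is (partial_derivs js f)"
  by (induction "is") auto

lemma partial_derivs_partial_deriv:
  fixes f :: "real ^ 'd::finite \<Rightarrow> real ^ 'd"
  assumes "C_diff (Suc (length js)) f"
  shows "partial_derivs js (partial_deriv i f) = partial_deriv i (partial_derivs js f)"
  using assms
proof (induction js)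
  case (Cons j js)
  have "C_diff 2 (partial_derivs js f)"
    using Cons.prems by (intro C_diff_partial_derivs) (simp del: C_diff.simps)
  moreover have "partial_derivs js (partial_deriv i f) = partial_deriv i (partial_derivs js f)"
    using Cons C_diff_mono[OF Cons.prems] by (simp del: C_diff.simps)
  ultimately show ?case by (simp add: partial_deriv_commute)
qed simp

text \<open>By induction on \<open>is\<close>: its head occurs somewhere in \<open>js\<close>, and
  that derivative is pulled to the front past the ones before it.\<close>

lemma partial_derivs_cong_mset:
  fixes f :: "real ^ 'd::finite \<Rightarrow> real ^ 'd"
  assumes "C_diff (length js) f" "mset is = mset js"
  shows "partial_derivs is f = partial_derivs js f"
  using assms
proof (induction "is" arbitrary: js)
  case (Cons i "is")
  then obtain us vs where js: "js = us @ i # vs"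
    by (metis list.set_intros(1) set_mset_mset split_list)
  then have m: "mset is = mset (us @ vs)" using Cons.prems by simp
  have "partial_derivs is f = partial_derivs (us @ vs) f"
    by (rule Cons.IH[OF _ m], rule C_diff_mono[OF Cons.prems(1)]) (simp add: js)
  moreover have "C_diff (Suc (length us)) (partial_derivs vs f)"
    using Cons.prems(1) js by (intro C_diff_partial_derivs) (simp del: C_diff.simps add: add_ac)
  ultimately show ?case
    by (simp add: js partial_derivs_append partial_derivs_partial_deriv)
qed simp

section \<open>Higher differentials and Taylor's theorem\<close>

text \<open>For smooth \<open>f\<close> this is the \<open>m\<close>-th differential of
  \<open>f\<close> at \<open>y\<close>, applied to \<open>m\<close> copies of \<open>v\<close>.
  Summing over index lists instead of multi-indices avoids multinomial factors here and matches the
  form of \<open>elem_diff\<close>.\<close>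

definition total_diff ::
  "nat \<Rightarrow> (real ^ 'd \<Rightarrow> real ^ 'd) \<Rightarrow> real ^ 'd \<Rightarrow> real ^ 'd \<Rightarrow> real ^ 'd::finite" where
  "total_diff m f y v =
    (\<Sum>js | length js = m. prod_list (map (\<lambda>j. v $ j) js) *\<^sub>R partial_derivs js f y)"

lemma finite_lists_length [simp]: "finite {js :: 'd::finite list. length js = m}"
  using finite_lists_length_eq[of "UNIV :: 'd set" m] by simp

text \<open>Differentiating a summand along the line adds one index in front of its list, and every
  list of length \<open>m + 1\<close> arises exactly once in this way.\<close>

lemma total_diff_has_vector_derivative:
  fixes f :: "real ^ 'd::finite \<Rightarrow> real ^ 'd"
  assumes "C_diff (Suc m) f"
  shows "((\<lambda>t. total_diff m f (y + t *\<^sub>R v) v) has_vector_derivative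
           total_diff (Suc m) f (y + t *\<^sub>R v) v) (at t)"
proof -
  have "((\<lambda>t. total_diff m f (y + t *\<^sub>R v) v) has_vector_derivative
     (\<Sum>js | length js = m. prod_list (map (\<lambda>j. v $ j) js) *\<^sub>R
        (\<Sum>i\<in>UNIV. v $ i *\<^sub>R partial_deriv i (partial_derivs js f) (y + t *\<^sub>R v)))) (at t)"
    unfolding total_diff_def
  proof (rule has_vector_derivative_sum)
    fix js :: "'d list" assume "js \<in> {js. length js = m}"
    then have "C_diff (Suc 0) (partial_derivs js f)"
      using assms by (intro C_diff_partial_derivs) (simp del: C_diff.simps)
    then show "((\<lambda>t. prod_list (map (\<lambda>j. v $ j) js) *\<^sub>R partial_derivs js f (y + t *\<^sub>R v))
      has_vector_derivative prod_list (map (\<lambda>j. v $ j) js) *\<^sub>R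
        (\<Sum>i\<in>UNIV. v $ i *\<^sub>R partial_deriv i (partial_derivs js f) (y + t *\<^sub>R v))) (at t)"
      by (intro bounded_linear.has_vector_derivative[OF bounded_linear_scaleR_right]
           has_vector_derivative_along_line) simp
  qed
  also have "(\<Sum>js | length js = m. prod_list (map (\<lambda>j. v $ j) js) *\<^sub>R
        (\<Sum>i\<in>UNIV. v $ i *\<^sub>R partial_deriv i (partial_derivs js f) (y + t *\<^sub>R v))) =
     (\<Sum>(js, i)\<in>{js. length js = m} \<times> UNIV. prod_list (map (\<lambda>j. v $ j) (i # js)) *\<^sub>R
        partial_derivs (i # js) f (y + t *\<^sub>R v))"
    by (simp add: scaleR_right.sum sum.cartesian_product mult_ac)
  also have "\<dots> = total_diff (Suc m) f (y + t *\<^sub>R v) v"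
    unfolding total_diff_def
    by (rule sum.reindex_bij_witness[of _ "\<lambda>js. (tl js, hd js)" "\<lambda>(js, i). i # js"])
       (auto simp: length_Suc_conv)
  finally show ?thesis .
qed

lemma abs_prod_list_le_norm_power:
  fixes v :: "real ^ 'd::finite"
  shows "\<bar>prod_list (map (\<lambda>j. v $ j) js)\<bar> \<le> norm v ^ length js"
  by (induction js) (auto simp: abs_mult intro!: mult_mono component_le_norm_cart)

text \<open>The integral form of the remainder is used for \<open>f\<close> on the segment from
  \<open>y\<close> to \<open>y + v\<close>. The condition on \<open>norm v\<close> keeps the segment
  in a fixed compact ball, on which the continuous derivatives of order \<open>q + 1\<close> are
  bounded; so \<open>C\<close> does not depend on \<open>v\<close>.\<close>

lemma taylor_bound:
  fixes f :: "real ^ 'd::finite \<Rightarrow> real ^ 'd"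
  assumes "C_diff (Suc q) f"
  obtains C where "\<And>v. norm v \<le> 1 \<Longrightarrow>
    norm (f (y + v) - (\<Sum>m\<le>q. (1 / fact m) *\<^sub>R total_diff m f y v)) \<le> C * norm v ^ Suc q"
proof -
  define J where "J = {js :: 'd list. length js = Suc q}"
  have "\<exists>B. \<forall>z\<in>cball y 1. norm (partial_derivs js f z) \<le> B" if "js \<in> J" for js
  proof -
    have "C_diff 0 (partial_derivs js f)"
      using assms that by (intro C_diff_partial_derivs) (simp add: J_def del: C_diff.simps)
    then have "continuous_on (cball y 1) (partial_derivs js f)"
      using continuous_on_subset by auto
    then have "bounded (partial_derivs js f ` cball y 1)"
      by (intro compact_imp_bounded compact_continuous_image) auto
    then show ?thesis unfolding bounded_iff by auto
  qed
  then obtain B where B: "\<And>js z. js \<in> J \<Longrightarrow> z \<in> cball y 1 \<Longrightarrow> norm (partial_derivs js f z) \<le> B js"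
    by metis
  define C where "C = (\<Sum>js\<in>J. B js)"
  have "norm (f (y + v) - (\<Sum>m\<le>q. (1 / fact m) *\<^sub>R total_diff m f y v)) \<le> C * norm v ^ Suc q"
    if v: "norm v \<le> 1" for v
  proof -
    have td: "norm (total_diff (Suc q) f z v) \<le> C * norm v ^ Suc q" if z: "z \<in> cball y 1" for z
    proof -
      have "norm (total_diff (Suc q) f z v) \<le> (\<Sum>js\<in>J. norm v ^ Suc q * B js)"
        unfolding total_diff_def J_def[symmetric]
      proof (intro order_trans[OF norm_sum] sum_mono)
        fix js assume js: "js \<in> J"
        then show "norm (prod_list (map (\<lambda>j. v $ j) js) *\<^sub>R partial_derivs js f z)
          \<le> norm v ^ Suc q * B js"
          using abs_prod_list_le_norm_power[of v js] B[OF js z]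
          unfolding norm_scaleR by (intro mult_mono) (auto simp: J_def)
      qed
      then show ?thesis by (simp add: C_def sum_distrib_left sum_distrib_right mult_ac)
    qed
    have I: "((\<lambda>t. ((1 - t) ^ (Suc q - 1) / fact (Suc q - 1)) *\<^sub>R total_diff (Suc q) f (y + t *\<^sub>R v) v)
      has_integral f (y + 1 *\<^sub>R v) -
        (\<Sum>i<Suc q. ((1 - 0) ^ i / fact i) *\<^sub>R total_diff i f (y + 0 *\<^sub>R v) v)) {0..1}"
    proof (rule Taylor_has_integral[where f = "\<lambda>t. f (y + t *\<^sub>R v)" and
          Df = "\<lambda>m t. total_diff m f (y + t *\<^sub>R v) v"])
      show "(\<lambda>t. total_diff 0 f (y + t *\<^sub>R v) v) = (\<lambda>t. f (y + t *\<^sub>R v))"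
        by (simp add: total_diff_def)
      show "((\<lambda>t. total_diff m f (y + t *\<^sub>R v) v) has_vector_derivative
         total_diff (Suc m) f (y + t *\<^sub>R v) v) (at t within {0..1})" if "m < Suc q" "0 \<le> t" "t \<le> 1" for m t
        using that by (intro has_vector_derivative_at_within[OF total_diff_has_vector_derivative]
             C_diff_mono[OF assms]) simp
    qed simp_all
    have "norm (f (y + v) - (\<Sum>m\<le>q. (1 / fact m) *\<^sub>R total_diff m f y v))
       \<le> C * norm v ^ Suc q * measure lborel (cbox 0 (1::real))"
    proof (rule has_integral_bound)
      \<comment> \<open>The bound is nonnegative because it dominates a norm, here the one at the
        centre of the ball.\<close>
      show "0 \<le> C * norm v ^ Suc q" using order_trans[OF norm_ge_zero td[of y]] by simp
      show "((\<lambda>t. ((1 - t) ^ q / fact q) *\<^sub>R total_diff (Suc q) f (y + t *\<^sub>R v) v)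
         has_integral f (y + v) - (\<Sum>m\<le>q. (1 / fact m) *\<^sub>R total_diff m f y v)) (cbox 0 1)"
        using I by (simp add: lessThan_Suc_atMost)
      fix t :: real assume "t \<in> cbox 0 1"
      then have t: "0 \<le> t" "t \<le> 1" by auto
      have "norm (total_diff (Suc q) f (y + t *\<^sub>R v) v) \<le> C * norm v ^ Suc q"
        using t v by (intro td) (auto simp: dist_norm intro: mult_le_one)
      moreover have "(1 - t) ^ q / fact q \<le> 1"
        using t order_trans[OF power_le_one fact_ge_1, of "1 - t" q q] by (simp add: divide_le_eq)
      ultimately show "norm (((1 - t) ^ q / fact q) *\<^sub>R total_diff (Suc q) f (y + t *\<^sub>R v) v)
        \<le> C * norm v ^ Suc q"
        using t mult_mono[of "(1 - t) ^ q / fact q" 1] by (simp add: abs_mult)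
    qed
    then show ?thesis by simp
  qed
  then show thesis by (rule that)
qed

section \<open>Taylor polynomials of sums indexed by trees\<close>

text \<open>The multilinear counterpart of \<open>total_diff\<close>, which is recovered when all
  entries of \<open>ws\<close> equal \<open>v\<close>. An elementary differential is this form
  evaluated at the elementary differentials of the children.\<close>

definition multi_diff ::
  "(real ^ 'd \<Rightarrow> real ^ 'd) \<Rightarrow> real ^ 'd \<Rightarrow> (real ^ 'd) list \<Rightarrow> real ^ 'd::finite" where
  "multi_diff f y ws =
    (\<Sum>js | length js = length ws. (\<Prod>l<length ws. ws ! l $ (js ! l)) *\<^sub>R partial_derivs js f y)"

lemma elem_diff_eq_multi_diff:
  fixes F :: "'n \<Rightarrow> real ^ 'd::finite \<Rightarrow> real ^ 'd"
  shows
  "elem_diff F (Node \<nu> X) y = multi_diff (F \<nu>) y (map (\<lambda>t. elem_diff F t y) (listing X))"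
proof -
  have "(\<Prod>l<length (listing X). elem_diff F (listing X ! l) y $ (js ! l)) =
    (\<Prod>l<length (listing X). map (\<lambda>t. elem_diff F t y) (listing X) ! l $ (js ! l))" for js :: "'d list"
    by (intro prod.cong) auto
  then show ?thesis by (simp add: multi_diff_def)
qed

text \<open>A permutation taking \<open>ws\<close> to \<open>vs\<close> is applied to the index
  lists as well: the coordinate products only have their factors reordered, and the partial
  derivatives commute. This makes the enumeration chosen by \<open>listing\<close>
  irrelevant.\<close>

lemma multi_diff_cong_mset:
  fixes f :: "real ^ 'd::finite \<Rightarrow> real ^ 'd"
  assumes f: "C_diff (length ws) f" and "mset vs = mset ws"
  shows "multi_diff f y vs = multi_diff f y ws"
proof -
  obtain p where p: "p permutes {..<length ws}" and vs: "vs = permute_list p ws"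
    using mset_eq_permutation[OF assms(2)] by metis
  have p': "inv p permutes {..<length ws}" using p by (rule permutes_inv)
  have "multi_diff f y ws = (\<Sum>js | length js = length ws.
      (\<Prod>l<length ws. ws ! l $ (js ! l)) *\<^sub>R partial_derivs js f y)"
    by (simp add: multi_diff_def)
  also have "\<dots> = (\<Sum>js | length js = length vs.
      (\<Prod>l<length vs. vs ! l $ (js ! l)) *\<^sub>R partial_derivs js f y)"
  proof (rule sum.reindex_bij_witness[of _ "permute_list (inv p)" "permute_list p"])
    fix js :: "'d list" assume "js \<in> {js. length js = length ws}"
    then have l: "length js = length ws" by simp
    then show "permute_list (inv p) (permute_list p js) = js"
      using permute_list_compose[of "inv p" js p] p p' by (simp add: permutes_inv_o)
    show "permute_list p js \<in> {js. length js = length vs}"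
      using l by (simp add: vs)
    have "(\<Prod>i<length vs. vs ! i $ (permute_list p js ! i)) =
          (\<Prod>i<length ws. ws ! p i $ (js ! p i))"
      using p l by (intro prod.cong) (auto simp: vs permute_list_nth)
    also have "\<dots> = (\<Prod>i<length ws. ws ! i $ (js ! i))"
      using prod.permute[OF p, of "\<lambda>i. ws ! i $ (js ! i)"] by (simp add: o_def)
    finally show "(\<Prod>i<length vs. vs ! i $ (permute_list p js ! i)) *\<^sub>R
        partial_derivs (permute_list p js) f y =
        (\<Prod>i<length ws. ws ! i $ (js ! i)) *\<^sub>R partial_derivs js f y"
      using partial_derivs_cong_mset[of js f "permute_list p js"] p l f by simp
  next
    fix js :: "'d list" assume "js \<in> {js. length js = length vs}"
    then have l: "length js = length ws" by (simp add: vs)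
    then show "permute_list p (permute_list (inv p) js) = js"
      using permute_list_compose[of p js "inv p"] p p' by (simp add: permutes_inv_o)
    show "permute_list (inv p) js \<in> {js. length js = length ws}"
      using l by simp
  qed
  finally show ?thesis by (simp add: multi_diff_def)
qed

section \<open>Multinomial expansion over lists and multisets\<close>

lemma prod_list_sum_distrib:
  fixes g :: "'a \<Rightarrow> 'b \<Rightarrow> 'c::comm_semiring_1"
  assumes "finite A"
  shows "prod_list (map (\<lambda>j. \<Sum>t\<in>A. g t j) js) =
    (\<Sum>ts | set ts \<subseteq> A \<and> length ts = length js. \<Prod>l<length js. g (ts ! l) (js ! l))"
proof (induction js)
  case Nil
  have "{ts :: 'a list. set ts \<subseteq> A \<and> ts = []} = {[]}" by auto
  then show ?case by simp
next
  case (Cons j js)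
  have "prod_list (map (\<lambda>j. \<Sum>t\<in>A. g t j) (j # js)) =
    (\<Sum>(t, ts)\<in>A \<times> {ts. set ts \<subseteq> A \<and> length ts = length js}.
       g t j * (\<Prod>l<length js. g (ts ! l) (js ! l)))"
    by (simp add: Cons.IH sum_product sum.cartesian_product)
  also have "\<dots> = (\<Sum>ts | set ts \<subseteq> A \<and> length ts = length (j # js).
      \<Prod>l<length (j # js). g (ts ! l) ((j # js) ! l))"
    by (rule sum.reindex_bij_witness[of _ "\<lambda>ts. (hd ts, tl ts)" "\<lambda>(t, ts). t # ts"])
       (auto simp: length_Suc_conv prod.lessThan_Suc_shift simp del: prod.lessThan_Suc)
  finally show ?case .
qed

text \<open>Each coordinate product is expanded by choosing one summand per factor; a choice is a
  list \<open>ts\<close>. Exchanging the sums over choices and over index lists then collects the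
  multilinear form of each choice.\<close>

lemma total_diff_sum:
  fixes f :: "real ^ 'd::finite \<Rightarrow> real ^ 'd"
  assumes "finite A"
  shows "total_diff m f y (\<Sum>t\<in>A. c t *\<^sub>R E t) =
    (\<Sum>ts | set ts \<subseteq> A \<and> length ts = m. prod_list (map c ts) *\<^sub>R multi_diff f y (map E ts))"
proof -
  have "prod_list (map (\<lambda>j. (\<Sum>t\<in>A. c t *\<^sub>R E t) $ j) js) =
     (\<Sum>ts | set ts \<subseteq> A \<and> length ts = m. prod_list (map c ts) * (\<Prod>l<m. map E ts ! l $ (js ! l)))"
    if "length js = m" for js
  proof -
    have "prod_list (map (\<lambda>j. (\<Sum>t\<in>A. c t *\<^sub>R E t) $ j) js) =
      (\<Sum>ts | set ts \<subseteq> A \<and> length ts = m. \<Prod>l<m. c (ts ! l) * E (ts ! l) $ (js ! l))"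
      using prod_list_sum_distrib[OF assms, of "\<lambda>t j. c t * E t $ j" js] that by simp
    also have "\<dots> = (\<Sum>ts | set ts \<subseteq> A \<and> length ts = m.
       prod_list (map c ts) * (\<Prod>l<m. map E ts ! l $ (js ! l)))"
      by (intro sum.cong)
         (auto simp: prod.distrib prod.list_conv_set_nth atLeast0LessThan intro!: prod.cong)
    finally show ?thesis .
  qed
  then have "total_diff m f y (\<Sum>t\<in>A. c t *\<^sub>R E t) = (\<Sum>js | length js = m.
     \<Sum>ts | set ts \<subseteq> A \<and> length ts = m.
       (prod_list (map c ts) * (\<Prod>l<m. map E ts ! l $ (js ! l))) *\<^sub>R partial_derivs js f y)"
    unfolding total_diff_def by (intro sum.cong refl) (simp only: mem_Collect_eq scaleR_left.sum)
  also have "\<dots> = (\<Sum>ts | set ts \<subseteq> A \<and> length ts = m. \<Sum>js | length js = m.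
       (prod_list (map c ts) * (\<Prod>l<m. map E ts ! l $ (js ! l))) *\<^sub>R partial_derivs js f y)"
    by (rule sum.swap)
  also have "\<dots> = (\<Sum>ts | set ts \<subseteq> A \<and> length ts = m.
      prod_list (map c ts) *\<^sub>R multi_diff f y (map E ts))"
    by (intro sum.cong) (auto simp: multi_diff_def scaleR_right.sum)
  finally show ?thesis .
qed

lemma finite_msets_le: "finite A \<Longrightarrow> finite {X. set_mset X \<subseteq> A \<and> size X \<le> q}"
proof -
  assume A: "finite A"
  have "{X. set_mset X \<subseteq> A \<and> size X \<le> q} \<subseteq> mset ` {xs. set xs \<subseteq> A \<and> length xs \<le> q}"
  proof
    fix X assume X: "X \<in> {X. set_mset X \<subseteq> A \<and> size X \<le> q}"
    obtain xs where "mset xs = X" using ex_mset by blast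
    with X show "X \<in> mset ` {xs. set xs \<subseteq> A \<and> length xs \<le> q}" by force
  qed
  then show ?thesis
    using finite_lists_length_le[OF A] by (auto intro: finite_subset)
qed

text \<open>The lists are grouped by their multiset. On a group the summand is constant by symmetry,
  and the group of \<open>X\<close> has \<open>m!\<close> divided by the product of the factorials
  of the multiplicities many members, so \<open>1 / fact m\<close> cancels.\<close>

lemma total_diff_sum_mset:
  fixes f :: "real ^ 'd::finite \<Rightarrow> real ^ 'd"
  assumes A: "finite A" and f: "C_diff m f"
  shows "(1 / fact m) *\<^sub>R total_diff m f y (\<Sum>t\<in>A. c t *\<^sub>R E t) =
    (\<Sum>X | set_mset X \<subseteq> A \<and> size X = m.
       (\<Prod>t\<in>set_mset X. c t ^ count X t / fact (count X t)) *\<^sub>R multi_diff f y (map E (listing X)))"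
proof -
  let ?L = "{ts. set ts \<subseteq> A \<and> length ts = m}" and ?M = "{X. set_mset X \<subseteq> A \<and> size X = m}"
  let ?g = "\<lambda>ts. prod_list (map c ts) *\<^sub>R multi_diff f y (map E ts)"
  have "sum ?g ?L = (\<Sum>X\<in>?M. sum ?g {ts \<in> ?L. mset ts = X})"
    using A by (intro sum.group[symmetric] finite_lists_length_eq
        finite_subset[OF _ finite_msets_le[OF A, of m]]) auto
  also have "\<dots> = (\<Sum>X\<in>?M. (fact m / (\<Prod>t\<in>set_mset X. fact (count X t))) *\<^sub>R
      (\<Prod>t\<in>set_mset X. c t ^ count X t) *\<^sub>R multi_diff f y (map E (listing X)))"
  proof (intro sum.cong refl)
    fix X assume X: "X \<in> ?M"
    then have "{ts \<in> ?L. mset ts = X} = permutations_of_multiset X"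
      by (auto simp: permutations_of_multiset_def)
    moreover have "?g ts = (\<Prod>t\<in>set_mset X. c t ^ count X t) *\<^sub>R multi_diff f y (map E (listing X))"
      if ts: "mset ts = X" for ts
    proof -
      have "length (listing X) = m"
        using X by (metis (mono_tags) mem_Collect_eq mset_listing size_mset)
      then have "multi_diff f y (map E ts) = multi_diff f y (map E (listing X))"
        using f ts by (intro multi_diff_cong_mset) simp_all
      moreover have "prod_list (map c ts) = prod_mset (image_mset c X)"
        using prod_mset_prod_list[of "map c ts"] ts by simp
      ultimately show ?thesis by (simp add: image_prod_mset_multiplicity)
    qed
    ultimately have "sum ?g {ts \<in> ?L. mset ts = X} = (\<Sum>ts\<in>permutations_of_multiset X.
      (\<Prod>t\<in>set_mset X. c t ^ count X t) *\<^sub>R multi_diff f y (map E (listing X)))"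
      by (intro sum.cong) (auto simp: permutations_of_multiset_def)
    also have "\<dots> = real (card (permutations_of_multiset X)) *\<^sub>R
      (\<Prod>t\<in>set_mset X. c t ^ count X t) *\<^sub>R multi_diff f y (map E (listing X))"
      by (rule sum_constant_scaleR)
    also have "real (card (permutations_of_multiset X)) =
      fact m / (\<Prod>t\<in>set_mset X. fact (count X t))"
    proof -
      have "real (card (permutations_of_multiset X) * (\<Prod>x\<in>set_mset X. fact (count X x))) = real (fact m)"
        using X card_permutations_of_multiset_aux[of X] by simp
      moreover have "(\<Prod>x\<in>set_mset X. fact (count X x)) \<noteq> (0 :: real)" by simp
      ultimately show ?thesis by (simp add: field_simps)
    qed
    finally show "sum ?g {ts \<in> ?L. mset ts = X} = (fact m / (\<Prod>t\<in>set_mset X. fact (count X t))) *\<^sub>R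
      (\<Prod>t\<in>set_mset X. c t ^ count X t) *\<^sub>R multi_diff f y (map E (listing X))" .
  qed
  finally show ?thesis
    using total_diff_sum[OF A, of m f y c E]
    by (simp add: scaleR_right.sum prod_dividef)
qed

lemma taylor_polynomial_sum_mset:
  fixes f :: "real ^ 'd::finite \<Rightarrow> real ^ 'd"
  assumes A: "finite A" and f: "C_diff q f"
  shows "(\<Sum>m\<le>q. (1 / fact m) *\<^sub>R total_diff m f y (\<Sum>t\<in>A. c t *\<^sub>R E t)) =
    (\<Sum>X | set_mset X \<subseteq> A \<and> size X \<le> q.
       (\<Prod>t\<in>set_mset X. c t ^ count X t / fact (count X t)) *\<^sub>R multi_diff f y (map E (listing X)))"
proof -
  let ?g = "\<lambda>X. (\<Prod>t\<in>set_mset X. c t ^ count X t / fact (count X t)) *\<^sub>R multi_diff f y (map E (listing X))"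
  have "(\<Sum>m\<le>q. (1 / fact m) *\<^sub>R total_diff m f y (\<Sum>t\<in>A. c t *\<^sub>R E t)) =
    (\<Sum>m\<le>q. \<Sum>X | set_mset X \<subseteq> A \<and> size X = m. ?g X)"
    by (intro sum.cong refl total_diff_sum_mset A C_diff_mono[OF f]) simp
  also have "\<dots> = (\<Sum>m\<le>q. sum ?g {X \<in> {X. set_mset X \<subseteq> A \<and> size X \<le> q}. size X = m})"
    by (intro sum.cong) auto
  also have "\<dots> = sum ?g {X. set_mset X \<subseteq> A \<and> size X \<le> q}"
    by (rule sum.group) (use finite_msets_le[OF A] in auto)
  finally show ?thesis .
qed

section \<open>Order estimates\<close>

lemma norm_add_bigo:
  fixes f g :: "'a \<Rightarrow> 'b::real_normed_vector" and r :: "'a \<Rightarrow> real"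
  assumes "(\<lambda>x. norm (f x)) \<in> O[G](r)" "(\<lambda>x. norm (g x)) \<in> O[G](r)"
  shows "(\<lambda>x. norm (f x + g x)) \<in> O[G](r)"
proof -
  have "(\<lambda>x. norm (f x + g x)) \<in> O[G](\<lambda>x. norm (f x) + norm (g x))"
    by (intro landau_o.big_mono always_eventually) (simp add: norm_triangle_ineq)
  also have "(\<lambda>x. norm (f x) + norm (g x)) \<in> O[G](r)"
    by (intro sum_in_bigo assms)
  finally show ?thesis .
qed

lemma norm_sum_bigo:
  fixes f :: "'i \<Rightarrow> 'a \<Rightarrow> 'b::real_normed_vector" and r :: "'a \<Rightarrow> real"
  assumes "\<And>i. i \<in> A \<Longrightarrow> (\<lambda>x. norm (f i x)) \<in> O[G](r)"
  shows "(\<lambda>x. norm (\<Sum>i\<in>A. f i x)) \<in> O[G](r)"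
  using assms by (induction A rule: infinite_finite_induct) (auto intro: norm_add_bigo)

lemma norm_scaleR_bigo:
  fixes f :: "'a \<Rightarrow> 'b::real_normed_vector" and c r s :: "'a \<Rightarrow> real"
  assumes "c \<in> O[G](r)" "(\<lambda>x. norm (f x)) \<in> O[G](s)"
  shows "(\<lambda>x. norm (c x *\<^sub>R f x)) \<in> O[G](\<lambda>x. r x * s x)"
proof -
  have "(\<lambda>x. \<bar>c x\<bar>) \<in> O[G](r)"
    using assms(1) by simp
  from landau_o.big.mult[OF this assms(2)] show ?thesis
    by simp
qed

lemma power_bigo_power_at_right_0:
  "m \<le> n \<Longrightarrow> (\<lambda>h::real. h ^ n) \<in> O[at_right 0](\<lambda>h. h ^ m)"
proof (rule landau_o.big_mono)
  assume "m \<le> n"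
  have "\<forall>\<^sub>F h in at_right (0::real). 0 < h \<and> h < 1"
    unfolding eventually_at_right_field by (intro exI[of _ 1]) auto
  then show "\<forall>\<^sub>F h in at_right (0::real). norm (h ^ n) \<le> norm (h ^ m)"
    by eventually_elim (use \<open>m \<le> n\<close> in \<open>auto intro: power_decreasing\<close>)
qed

lemma prod_mset_bigo_1:
  assumes "\<And>t. t \<in># X \<Longrightarrow> w t \<in> O[G](\<lambda>_. 1 :: real)"
  shows "(\<lambda>h. \<Prod>t\<in>#X. w t h :: real) \<in> O[G](\<lambda>_. 1)"
  using assms by (induction X) (auto intro: landau_o.big.mult_in_1)

section \<open>Perturbation and remainder of Taylor polynomials\<close>

text \<open>Telescoping: a difference of products changes one factor at a time, with all other
  factors bounded.\<close>

lemma prod_list_diff_bigo: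
  fixes u v :: "'a \<Rightarrow> real ^ 'd::finite" and r :: "'a \<Rightarrow> real"
  assumes u: "(\<lambda>x. norm (u x)) \<in> O[G](\<lambda>_. 1)" and v: "(\<lambda>x. norm (v x)) \<in> O[G](\<lambda>_. 1)"
    and uv: "(\<lambda>x. norm (u x - v x)) \<in> O[G](r)"
  shows "(\<lambda>x. prod_list (map (\<lambda>j. u x $ j) js) - prod_list (map (\<lambda>j. v x $ j) js)) \<in> O[G](r)"
proof -
  have nth: "(\<lambda>x. w x $ j) \<in> O[G](s)" if "(\<lambda>x. norm (w x)) \<in> O[G](s)"
    for w :: "'a \<Rightarrow> real ^ 'd" and s :: "'a \<Rightarrow> real" and j
  proof -
    have "(\<lambda>x. w x $ j) \<in> O[G](\<lambda>x. norm (w x))"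
      by (intro landau_o.big_mono always_eventually) (simp add: component_le_norm_cart)
    then show ?thesis using that landau_o.big_trans by blast
  qed
  have prod: "(\<lambda>x. prod_list (map (\<lambda>j. v x $ j) js)) \<in> O[G](\<lambda>_. 1)" for js
    by (induction js) (simp_all add: landau_o.big.mult_in_1 nth[OF v])
  show ?thesis
  proof (induction js)
    case (Cons j js)
    have "(\<lambda>x. u x $ j * (prod_list (map (\<lambda>j. u x $ j) js) - prod_list (map (\<lambda>j. v x $ j) js))
        + (u x - v x) $ j * prod_list (map (\<lambda>j. v x $ j) js)) \<in> O[G](r)"
      using landau_o.big.mult[OF nth[OF u] Cons] landau_o.big.mult[OF nth[OF uv] prod]
      by (intro sum_in_bigo) auto
    then show ?case by (simp add: algebra_simps)
  qed simp
qed

text \<open>With \<open>y\<close> fixed, the Taylor polynomial is a polynomial in the coordinates of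
  the displacement, so on bounded arguments it changes at most by a multiple of the change of its
  argument.\<close>

lemma taylor_polynomial_diff_bigo:
  fixes u v :: "'a \<Rightarrow> real ^ 'd::finite" and r :: "'a \<Rightarrow> real"
  assumes "(\<lambda>x. norm (u x)) \<in> O[G](\<lambda>_. 1)" "(\<lambda>x. norm (v x)) \<in> O[G](\<lambda>_. 1)"
    and "(\<lambda>x. norm (u x - v x)) \<in> O[G](r)"
  shows "(\<lambda>x. norm ((\<Sum>m\<le>q. (1 / fact m) *\<^sub>R total_diff m f y (u x)) -
    (\<Sum>m\<le>q. (1 / fact m) *\<^sub>R total_diff m f y (v x)))) \<in> O[G](r)"
proof -
  have "(\<lambda>x. norm ((1 / fact m) *\<^sub>R (\<Sum>js | length js = m.
      (prod_list (map (\<lambda>j. u x $ j) js) - prod_list (map (\<lambda>j. v x $ j) js)) *\<^sub>R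
      partial_derivs js f y))) \<in> O[G](\<lambda>x. 1 * r x)" for m
  proof (intro norm_scaleR_bigo norm_sum_bigo)
    fix js
    show "(\<lambda>x. norm ((prod_list (map (\<lambda>j. u x $ j) js) - prod_list (map (\<lambda>j. v x $ j) js)) *\<^sub>R
      partial_derivs js f y)) \<in> O[G](r)"
      using norm_scaleR_bigo[OF prod_list_diff_bigo[OF assms], of "\<lambda>_. partial_derivs js f y" "\<lambda>_. 1"]
      by simp
  qed simp
  then have "(\<lambda>x. norm (\<Sum>m\<le>q. (1 / fact m) *\<^sub>R (\<Sum>js | length js = m.
      (prod_list (map (\<lambda>j. u x $ j) js) - prod_list (map (\<lambda>j. v x $ j) js)) *\<^sub>R
      partial_derivs js f y))) \<in> O[G](r)"
    by (intro norm_sum_bigo) simp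
  moreover have "(\<Sum>m\<le>q. (1 / fact m) *\<^sub>R (\<Sum>js | length js = m.
      (prod_list (map (\<lambda>j. u x $ j) js) - prod_list (map (\<lambda>j. v x $ j) js)) *\<^sub>R
      partial_derivs js f y)) = (\<Sum>m\<le>q. (1 / fact m) *\<^sub>R total_diff m f y (u x)) -
      (\<Sum>m\<le>q. (1 / fact m) *\<^sub>R total_diff m f y (v x))" for x
    unfolding total_diff_def
    by (simp only: sum_subtractf scaleR_diff_left scaleR_diff_right)
  ultimately show ?thesis by (simp only:)
qed

lemma taylor_bigo:
  fixes f :: "real ^ 'd::finite \<Rightarrow> real ^ 'd" and z :: "real \<Rightarrow> real ^ 'd"
  assumes f: "C_diff (Suc q) f" and z: "(\<lambda>h. norm (z h)) \<in> O[at_right 0](\<lambda>h. h)"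
  shows "(\<lambda>h. norm (f (y + z h) - (\<Sum>m\<le>q. (1 / fact m) *\<^sub>R total_diff m f y (z h))))
    \<in> O[at_right 0](\<lambda>h. h ^ Suc q)"
proof -
  obtain C where C: "\<And>v. norm v \<le> 1 \<Longrightarrow>
    norm (f (y + v) - (\<Sum>m\<le>q. (1 / fact m) *\<^sub>R total_diff m f y v)) \<le> C * norm v ^ Suc q"
    by (rule taylor_bound[OF f, of y]) (rule that)
  obtain c where c: "c > 0" "\<forall>\<^sub>F h in at_right 0. norm (norm (z h)) \<le> c * norm h"
    by (rule landau_o.bigE[OF z]) (rule that)
  \<comment> \<open>Below \<open>1 / c\<close> the displacement \<open>z h\<close> has norm at most
    1, as \<open>taylor_bound\<close> requires.\<close>
  have "\<forall>\<^sub>F h in at_right (0::real). 0 < h \<and> h < 1 / c"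
    unfolding eventually_at_right_field using c(1) by (intro exI[of _ "1 / c"]) auto
  with c(2) have "\<forall>\<^sub>F h in at_right 0. norm (z h) \<le> 1"
  proof eventually_elim
    case (elim h)
    then show ?case using c(1) by (simp add: field_simps)
  qed
  then have "\<forall>\<^sub>F h in at_right 0.
      norm (norm (f (y + z h) - (\<Sum>m\<le>q. (1 / fact m) *\<^sub>R total_diff m f y (z h)))) \<le>
      C * norm (norm (z h) ^ Suc q)"
    by eventually_elim (use C in simp)
  then have "(\<lambda>h. norm (f (y + z h) - (\<Sum>m\<le>q. (1 / fact m) *\<^sub>R total_diff m f y (z h))))
    \<in> O[at_right 0](\<lambda>h. norm (z h) ^ Suc q)"
    by (rule bigoI)
  also have "(\<lambda>h. norm (z h) ^ Suc q) \<in> O[at_right 0](\<lambda>h. h ^ Suc q)"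
    using z by (rule landau_o.big_power)
  finally show ?thesis .
qed

section \<open>From multisets of children to trees\<close>

lemma num_nodes_pos: "num_nodes \<tau> > 0"
  by (cases \<tau>) simp

text \<open>The factorials of the multinomial expansion and the symmetries of the children are
  exactly the factors in the recursion for \<open>symmetry\<close>. The color \<open>\<mu>\<close>
  is arbitrary because symmetry ignores the root color. The power of \<open>h\<close> counts all
  nodes but the root.\<close>

lemma symmetry_Node_coefficient:
  fixes w :: "'c ctree \<Rightarrow> real"
  shows "(\<Prod>t\<in>set_mset X. (1 / real (symmetry t) * w t * h ^ num_nodes t) ^ count X t
      / fact (count X t)) =
    1 / real (symmetry (Node \<mu> X)) * (\<Prod>t\<in>#X. w t) * h ^ (\<Sum>t\<in>#X. num_nodes t)"
proof -
  have "h ^ (\<Sum>t\<in>#X. num_nodes t) = (\<Prod>t\<in>#X. h ^ num_nodes t)"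
    by (induction X) (simp_all add: power_add)
  then show ?thesis
    by (simp add: image_prod_mset_multiplicity prod.distrib[symmetric] prod_dividef[symmetric]
        power_mult_distrib power_divide mult_ac)
qed

text \<open>Removing the root turns a tree with at most \<open>q + 1\<close> nodes into a multiset
  of children with at most \<open>q\<close> nodes in total. The index set repeats the bounds of
  \<open>taylor_polynomial_sum_mset\<close>, so that it is a subset of the one there.\<close>

lemma sum_NT_Suc_color:
  fixes H :: "'n::finite ctree \<Rightarrow> 'b::comm_monoid_add"
  assumes "\<And>\<mu> X. \<mu> \<noteq> \<nu> \<Longrightarrow> H (Node \<mu> X) = 0"
  shows "sum H (NT (Suc q)) =
    (\<Sum>X | set_mset X \<subseteq> NT q \<and> size X \<le> q \<and> (\<Sum>t\<in>#X. num_nodes t) \<le> q. H (Node \<nu> X))"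
proof -
  let ?K = "{X. set_mset X \<subseteq> NT q \<and> size X \<le> q \<and> (\<Sum>t\<in>#X. num_nodes t) \<le> q}"
  have "X \<in> ?K" if X: "(\<Sum>t\<in>#X. num_nodes t) \<le> q" for X :: "'n ctree multiset"
  proof -
    have "num_nodes t \<le> q" if "t \<in># X" for t
      \<comment> \<open>Any root color will do, since node counts do not depend on it.\<close>
      using num_nodes_child[OF that, of undefined] X by simp
    then show ?thesis using X size_le_sum_num_nodes[of X] by (auto simp: NT_def)
  qed
  then have NT: "Node \<mu> X \<in> NT (Suc q) \<longleftrightarrow> X \<in> ?K" for \<mu> and X :: "'n ctree multiset"
    by (auto simp: NT_def)
  have "sum H (NT (Suc q)) = sum H (Node \<nu> ` ?K)"
  proof (rule sum.mono_neutral_right)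
    show "\<forall>\<tau>\<in>NT (Suc q) - Node \<nu> ` ?K. H \<tau> = 0"
    proof
      fix \<tau> assume "\<tau> \<in> NT (Suc q) - Node \<nu> ` ?K"
      then show "H \<tau> = 0" using NT assms by (cases \<tau>) blast
    qed
  qed (use NT finite_NT in auto)
  also have "\<dots> = (\<Sum>X\<in>?K. H (Node \<nu> X))"
    by (subst sum.reindex) (auto simp: inj_on_def)
  finally show ?thesis .
qed

text \<open>The gain of one order. In the Taylor polynomial at the truncated series, the multisets
  of children with at most \<open>q\<close> nodes in total yield the trees of
  \<open>NT (Suc q)\<close> with root color \<open>\<nu>\<close>; the factor \<open>h\<close>
  supplies the power for the root and raises the error by one order.\<close>

lemma series_compose_bigo:
  fixes F :: "'n::finite \<Rightarrow> real ^ 'd::finite \<Rightarrow> real ^ 'd"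
    and z :: "real \<Rightarrow> real ^ 'd" and w g :: "'n ctree \<Rightarrow> real \<Rightarrow> real"
  assumes F: "C_diff (Suc q) (F \<nu>)"
    and w: "\<And>\<tau>. w \<tau> \<in> O[at_right 0](\<lambda>_. 1)"
    and g: "\<And>\<mu> X h. g (Node \<mu> X) h = (if \<nu> = \<mu> then 1 else 0) * (\<Prod>t\<in>#X. w t h)"
    and z: "(\<lambda>h. norm (z h - (\<Sum>\<tau>\<in>NT q.
       (1 / real (symmetry \<tau>) * w \<tau> h * h ^ num_nodes \<tau>) *\<^sub>R elem_diff F \<tau> y)))
       \<in> O[at_right 0](\<lambda>h. h ^ Suc q)"
  shows "(\<lambda>h. norm (h *\<^sub>R F \<nu> (y + z h) - (\<Sum>\<tau>\<in>NT (Suc q).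
       (1 / real (symmetry \<tau>) * g \<tau> h * h ^ num_nodes \<tau>) *\<^sub>R elem_diff F \<tau> y)))
       \<in> O[at_right 0](\<lambda>h. h ^ Suc (Suc q))"
proof -
  define c where "c h t = 1 / real (symmetry t) * w t h * h ^ num_nodes t" for h t
  define S where "S h = (\<Sum>\<tau>\<in>NT q. c h \<tau> *\<^sub>R elem_diff F \<tau> y)" for h
  have summand: "(\<lambda>h. norm ((1 / s * v h * h ^ n) *\<^sub>R e)) \<in> O[at_right 0](\<lambda>h. h ^ m)"
    if "v \<in> O[at_right 0](\<lambda>_. 1)" "m \<le> n" for s n m v and e :: "real ^ 'd"
  proof -
    have "(\<lambda>h. 1 / s * v h) \<in> O[at_right 0](\<lambda>_. 1)"
      using that(1) by (intro landau_o.big.mult_in_1) auto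
    then have "(\<lambda>h. 1 / s * v h * h ^ n) \<in> O[at_right 0](\<lambda>h. 1 * h ^ m)"
      by (intro landau_o.big.mult power_bigo_power_at_right_0 that)
    from norm_scaleR_bigo[OF this, of "\<lambda>_. e" "\<lambda>_. 1"] show ?thesis by simp
  qed
  have h1: "(\<lambda>h::real. h) \<in> O[at_right 0](\<lambda>_. 1)"
    using power_bigo_power_at_right_0[of 0 1] by simp
  \<comment> \<open>Every tree has at least one node, so the series has no constant term.\<close>
  have "(\<lambda>h. norm (S h)) \<in> O[at_right 0](\<lambda>h. h ^ 1)"
    unfolding S_def c_def by (intro norm_sum_bigo summand w) (simp add: num_nodes_pos Suc_leI)
  then have S_h: "(\<lambda>h. norm (S h)) \<in> O[at_right 0](\<lambda>h. h)"
    by simp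
  have zS: "(\<lambda>h. norm (z h - S h)) \<in> O[at_right 0](\<lambda>h. h ^ Suc q)"
    using z by (simp add: S_def c_def)
  have "(\<lambda>h. norm (z h - S h)) \<in> O[at_right 0](\<lambda>h. h)"
    using landau_o.big_trans[OF zS power_bigo_power_at_right_0[of 1 "Suc q"]] by simp
  from norm_add_bigo[OF this S_h] have z_h: "(\<lambda>h. norm (z h)) \<in> O[at_right 0](\<lambda>h. h)"
    by simp
  let ?P = "\<lambda>v. \<Sum>m\<le>q. (1 / fact m) *\<^sub>R total_diff m (F \<nu>) y v"
  let ?M = "{X :: 'n ctree multiset. set_mset X \<subseteq> NT q \<and> size X \<le> q}"
  let ?K = "{X :: 'n ctree multiset.
      set_mset X \<subseteq> NT q \<and> size X \<le> q \<and> (\<Sum>t\<in>#X. num_nodes t) \<le> q}"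
  let ?T = "\<lambda>h X. (1 / real (symmetry (Node \<nu> X)) * (\<Prod>t\<in>#X. w t h) *
      h ^ (\<Sum>t\<in>#X. num_nodes t)) *\<^sub>R elem_diff F (Node \<nu> X) y"
  have fin: "finite ?M" by (intro finite_msets_le finite_NT)
  have "?P (S h) = sum (?T h) ?M" for h
    unfolding S_def taylor_polynomial_sum_mset[OF finite_NT C_diff_Suc_imp[OF F]] c_def
      elem_diff_eq_multi_diff symmetry_Node_coefficient[where \<mu> = \<nu>] ..
  also have "sum (?T h) ?M = sum (?T h) ?K + sum (?T h) (?M - ?K)" for h
    using fin by (subst sum.subset_diff[of ?K ?M]) (auto simp: add.commute)
  finally have PS: "?P (S h) - sum (?T h) ?K = sum (?T h) (?M - ?K)" for h by simp
  \<comment> \<open>A multiset in \<open>?M\<close> but not in \<open>?K\<close> has at least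
    \<open>q + 1\<close> nodes in total, so its term is of the order of the error.\<close>
  have tail: "(\<lambda>h. norm (?P (S h) - sum (?T h) ?K)) \<in> O[at_right 0](\<lambda>h. h ^ Suc q)"
    unfolding PS by (intro norm_sum_bigo summand prod_mset_bigo_1 w) auto
  \<comment> \<open>Three errors of the same order: the Taylor remainder, the replacement of the
    displacement by its series, and the tail of multisets with too many nodes.\<close>
  have "(\<lambda>h. norm ((F \<nu> (y + z h) - ?P (z h)) + (?P (z h) - ?P (S h)) + (?P (S h) - sum (?T h) ?K)))
      \<in> O[at_right 0](\<lambda>h. h ^ Suc q)"
    by (intro norm_add_bigo tail taylor_bigo[OF F z_h] taylor_polynomial_diff_bigo zS
        landau_o.big_trans[OF S_h h1] landau_o.big_trans[OF z_h h1])
  then have "(\<lambda>h. norm (F \<nu> (y + z h) - sum (?T h) ?K)) \<in> O[at_right 0](\<lambda>h. h ^ Suc q)"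
    by simp
  from norm_scaleR_bigo[OF landau_o.big_refl[of "\<lambda>h. h"] this]
  have "(\<lambda>h. norm (h *\<^sub>R (F \<nu> (y + z h) - sum (?T h) ?K))) \<in> O[at_right 0](\<lambda>h. h ^ Suc (Suc q))"
    by simp
  moreover have "(\<Sum>\<tau>\<in>NT (Suc q).
       (1 / real (symmetry \<tau>) * g \<tau> h * h ^ num_nodes \<tau>) *\<^sub>R elem_diff F \<tau> y) = h *\<^sub>R sum (?T h) ?K" for h
    by (subst sum_NT_Suc_color[where \<nu> = \<nu>])
       (simp_all add: g scaleR_right.sum mult_ac del: symmetry.simps elem_diff.simps)
  ultimately show ?thesis by (simp add: scaleR_diff_right)
qed

section \<open>Solution-dependent weights of a step\<close>

text \<open>At a fixed tree, bounds for \<open>nsark_g\<close> pass to \<open>nsark_d\<close>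
  through the bounded coefficients; bounds for \<open>nsark_d\<close> at the children give those for
  \<open>nsark_g\<close> at the node. Structural induction closes the circle.\<close>

lemma nsark_weights_bigo_1:
  assumes "\<And>\<nu> i j. (\<lambda>h. a \<nu> i j (Y h) h) \<in> O[G](\<lambda>_. 1)"
  shows "(\<lambda>h. nsark_g a \<nu> i \<tau> (Y h) h) \<in> O[G](\<lambda>_. 1)"
    and "(\<lambda>h. nsark_d a i \<tau> (Y h) h) \<in> O[G](\<lambda>_. 1)"
proof -
  have d: "(\<lambda>h. nsark_d a i \<tau> (Y h) h) \<in> O[G](\<lambda>_. 1)"
    if "\<And>\<nu> j. (\<lambda>h. nsark_g a \<nu> j \<tau> (Y h) h) \<in> O[G](\<lambda>_. 1)" for i \<tau>
    unfolding nsark_d.simps[abs_def]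
    by (intro big_sum_in_bigo landau_o.big.mult_in_1 assms that)
  show g: "(\<lambda>h. nsark_g a \<nu> i \<tau> (Y h) h) \<in> O[G](\<lambda>_. 1)" for \<nu> i
  proof (induction \<tau> arbitrary: \<nu> i)
    case (Node \<mu> ts)
    have "(\<lambda>h. \<Prod>t\<in>#ts. nsark_d a i t (Y h) h) \<in> O[G](\<lambda>_. 1)"
      by (intro prod_mset_bigo_1 d Node)
    then show ?case by simp
  qed
  show "(\<lambda>h. nsark_d a i \<tau> (Y h) h) \<in> O[G](\<lambda>_. 1)"
    by (intro d g)
qed

text \<open>A priori bound: the stages satisfy a fixed-point inequality that is contractive for small
  \<open>h\<close>, so they stay bounded.\<close>

lemma F_stages_bigo_1:
  fixes F :: "'n::finite \<Rightarrow> real ^ 'd::finite \<Rightarrow> real ^ 'd"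
    and ys :: "real \<Rightarrow> 's::finite \<Rightarrow> real ^ 'd" and \<alpha> :: "'n \<Rightarrow> 's \<Rightarrow> 's \<Rightarrow> real \<Rightarrow> real"
  assumes lip: "\<And>\<nu>. \<exists>L. L-lipschitz_on UNIV (F \<nu>)"
    and step: "\<forall>\<^sub>F h in at_right 0. \<forall>i. ys h i =
      y0 + h *\<^sub>R (\<Sum>j\<in>UNIV. \<Sum>\<nu>\<in>UNIV. \<alpha> \<nu> i j h *\<^sub>R F \<nu> (ys h j))"
    and \<alpha>: "\<And>\<nu> i j. \<alpha> \<nu> i j \<in> O[at_right 0](\<lambda>_. 1)"
  shows "(\<lambda>h. norm (F \<nu> (ys h i))) \<in> O[at_right 0](\<lambda>_. 1)"
proof -
  obtain l where l: "\<And>\<nu>. (l \<nu>)-lipschitz_on UNIV (F \<nu>)"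
    using lip by metis
  \<comment> \<open>Sums replace maxima here and for \<open>K\<close>, \<open>A\<close> and
    \<open>M\<close>: each dominates all of its nonnegative summands.\<close>
  define L where "L = (\<Sum>\<nu>\<in>UNIV. l \<nu>)"
  define K where "K = (\<Sum>\<nu>\<in>UNIV. norm (F \<nu> y0))"
  have l0: "l \<nu> \<ge> 0" for \<nu> using lipschitz_on_nonneg[OF l] .
  have L0: "L \<ge> 0" and K0: "K \<ge> 0" unfolding L_def K_def by (auto intro: sum_nonneg l0)
  have growth: "norm (F \<nu> y) \<le> K + L * norm (y - y0)" for \<nu> y
  proof -
    have "norm (F \<nu> y) \<le> norm (F \<nu> y0) + norm (F \<nu> y - F \<nu> y0)"
      using norm_triangle_ineq[of "F \<nu> y0" "F \<nu> y - F \<nu> y0"] by simp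
    also have "norm (F \<nu> y - F \<nu> y0) \<le> l \<nu> * norm (y - y0)"
      using lipschitz_onD[OF l, of y y0 \<nu>] by (simp add: dist_norm)
    also have "\<dots> \<le> L * norm (y - y0)"
      unfolding L_def by (intro mult_right_mono member_le_sum l0) auto
    also have "norm (F \<nu> y0) \<le> K"
      unfolding K_def by (intro member_le_sum) auto
    finally show ?thesis by simp
  qed
  have "\<exists>c. \<forall>\<^sub>F h in at_right 0. \<bar>\<alpha> \<nu> i j h\<bar> \<le> c" for \<nu> i j
  proof (rule landau_o.bigE[OF \<alpha>[of \<nu> i j]])
    fix c assume "\<forall>\<^sub>F h in at_right (0::real). norm (\<alpha> \<nu> i j h) \<le> c * norm (1::real)"
    then show ?thesis by auto
  qed
  then obtain c where c: "\<And>\<nu> i j. \<forall>\<^sub>F h in at_right 0. \<bar>\<alpha> \<nu> i j h\<bar> \<le> c \<nu> i j"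
    by metis
  define A where "A = (\<Sum>i\<in>UNIV. \<Sum>j\<in>UNIV. \<Sum>\<nu>\<in>UNIV. \<bar>c \<nu> i j\<bar>)"
  have A0: "A \<ge> 0" unfolding A_def by (intro sum_nonneg) auto
  \<comment> \<open>The threshold makes \<open>h * (A * L)\<close> at most one half, so the stage
    deviation can be absorbed; the added 1 keeps the denominator positive when \<open>A * L\<close>
    vanishes.\<close>
  have small: "\<forall>\<^sub>F h in at_right (0::real). 0 < h \<and> h < min 1 (1 / (2 * (A * L + 1)))"
    unfolding eventually_at_right_field using A0 L0
    by (intro exI[of _ "min 1 (1 / (2 * (A * L + 1)))"]) (auto simp: add_nonneg_pos)
  have "\<forall>\<^sub>F h in at_right 0. \<forall>\<nu> i j. \<bar>\<alpha> \<nu> i j h\<bar> \<le> c \<nu> i j"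
    using c by (intro eventually_all_finite) auto
  with small step have bound: "\<forall>\<^sub>F h in at_right 0. norm (F \<nu> (ys h i)) \<le> K + L * (2 * A * K)"
  proof eventually_elim
    case (elim h)
    have "2 * (A * L + 1) > 0" using A0 L0 by (simp add: add_nonneg_pos)
    with elim have h: "h > 0" "h < 1" "h * (2 * (A * L + 1)) < 1"
      by (simp_all add: pos_less_divide_eq del: distrib_left_numeral)
    have ys: "ys h i = y0 + h *\<^sub>R (\<Sum>j\<in>UNIV. \<Sum>\<nu>\<in>UNIV. \<alpha> \<nu> i j h *\<^sub>R F \<nu> (ys h j))"
      and \<alpha>_le: "\<bar>\<alpha> \<nu> i j h\<bar> \<le> c \<nu> i j" for \<nu> i j
      using elim by blast+
    define M where "M = (\<Sum>i\<in>UNIV. norm (ys h i - y0))"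
    have M0: "M \<ge> 0" unfolding M_def by (intro sum_nonneg) auto
    have M: "norm (ys h j - y0) \<le> M" for j
      unfolding M_def by (intro member_le_sum) auto
    have FM: "norm (F \<nu> (ys h j)) \<le> K + L * M" for \<nu> j
      using growth[of \<nu> "ys h j"] mult_left_mono[OF M[of j] L0]
      by (meson add_left_mono order_trans)
    have "norm (ys h i - y0) \<le> h * (\<Sum>j\<in>UNIV. \<Sum>\<nu>\<in>UNIV. \<bar>c \<nu> i j\<bar> * (K + L * M))" for i
    proof -
      have "ys h i - y0 = h *\<^sub>R (\<Sum>j\<in>UNIV. \<Sum>\<nu>\<in>UNIV. \<alpha> \<nu> i j h *\<^sub>R F \<nu> (ys h j))"
        by (subst ys) simp
      moreover have "norm (\<Sum>j\<in>UNIV. \<Sum>\<nu>\<in>UNIV. \<alpha> \<nu> i j h *\<^sub>R F \<nu> (ys h j)) \<le>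
          (\<Sum>j\<in>UNIV. \<Sum>\<nu>\<in>UNIV. \<bar>c \<nu> i j\<bar> * (K + L * M))"
      proof (intro sum_norm_le)
        fix j \<nu>
        have "\<bar>\<alpha> \<nu> i j h\<bar> \<le> \<bar>c \<nu> i j\<bar>" by (rule order_trans[OF \<alpha>_le abs_ge_self])
        then show "norm (\<alpha> \<nu> i j h *\<^sub>R F \<nu> (ys h j)) \<le> \<bar>c \<nu> i j\<bar> * (K + L * M)"
          unfolding norm_scaleR by (intro mult_mono FM) auto
      qed
      ultimately show ?thesis
        using mult_left_mono[of _ _ h] h(1) by (simp only: norm_scaleR abs_of_pos less_imp_le)
    qed
    then have "M \<le> (\<Sum>i\<in>UNIV. h * (\<Sum>j\<in>UNIV. \<Sum>\<nu>\<in>UNIV. \<bar>c \<nu> i j\<bar> * (K + L * M)))"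
      unfolding M_def by (intro sum_mono)
    also have "\<dots> = h * (A * (K + L * M))"
      by (simp add: A_def sum_distrib_left sum_distrib_right mult_ac)
    also have "\<dots> = h * (A * K) + h * (A * L) * M" by (simp add: algebra_simps)
    also have "h * (A * K) \<le> A * K"
      using h A0 K0 by (intro mult_left_le_one_le) auto
    also have "h * (A * L) * M \<le> 1 / 2 * M"
    proof (rule mult_right_mono)
      have "h * (2 * (A * L + 1)) = 2 * (h * (A * L)) + 2 * h" by (simp add: algebra_simps)
      then show "h * (A * L) \<le> 1 / 2" using h by linarith
    qed (rule M0)
    \<comment> \<open>From \<open>M\<close> being at most \<open>A * K\<close> plus half of
      \<open>M\<close>; this is the source of the constant in \<open>bound\<close>.\<close>
    finally have "M \<le> 2 * A * K" by simp
    with FM[of \<nu> i] show ?case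
      using mult_left_mono[of M "2 * A * K" L] L0 by linarith
  qed
  show ?thesis
    by (rule bigoI[of _ "K + L * (2 * A * K)"]) (use bound in simp)
qed

section \<open>Linear combinations of tree expansions\<close>

lemma norm_bigo_cong:
  fixes f g :: "'a \<Rightarrow> 'b::real_normed_vector" and r :: "'a \<Rightarrow> real"
  assumes "\<forall>\<^sub>F x in G. f x = g x" "(\<lambda>x. norm (f x)) \<in> O[G](r)"
  shows "(\<lambda>x. norm (g x)) \<in> O[G](r)"
proof -
  have "\<forall>\<^sub>F x in G. norm (f x) = norm (g x)"
    using assms(1) by (rule eventually_mono) simp
  from landau_o.big.in_cong[OF this, of r] assms(2) show ?thesis by (simp only:)
qed

text \<open>The new error is exactly the combination of the old errors with the bounded coefficients
  \<open>\<beta>\<close>. The stages, with weights \<open>nsark_d\<close>, and the new value, with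
  weights \<open>nsark_u\<close>, are both instances.\<close>

lemma series_linear_combination_bigo:
  fixes e :: "'n::finite \<Rightarrow> 's::finite \<Rightarrow> real \<Rightarrow> real ^ 'd::finite"
    and \<gamma> :: "'n \<Rightarrow> 's \<Rightarrow> 'n ctree \<Rightarrow> real \<Rightarrow> real"
  assumes e: "\<And>\<nu> j. (\<lambda>h. norm (h *\<^sub>R e \<nu> j h - (\<Sum>\<tau>\<in>NT q.
       (1 / real (symmetry \<tau>) * \<gamma> \<nu> j \<tau> h * h ^ num_nodes \<tau>) *\<^sub>R E \<tau>)))
       \<in> O[at_right 0](r)"
    and \<beta>: "\<And>\<nu> j. \<beta> \<nu> j \<in> O[at_right 0](\<lambda>_. 1)"
    and y: "\<forall>\<^sub>F h in at_right 0. y h = y0 + h *\<^sub>R (\<Sum>j\<in>UNIV. \<Sum>\<nu>\<in>UNIV. \<beta> \<nu> j h *\<^sub>R e \<nu> j h)"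
  shows "(\<lambda>h. norm (y h - (y0 + (\<Sum>\<tau>\<in>NT q.
       (1 / real (symmetry \<tau>) * (\<Sum>\<nu>\<in>UNIV. \<Sum>j\<in>UNIV. \<beta> \<nu> j h * \<gamma> \<nu> j \<tau> h) * h ^ num_nodes \<tau>)
         *\<^sub>R E \<tau>)))) \<in> O[at_right 0](r)"
proof -
  let ?c = "\<lambda>\<nu> j \<tau> h. 1 / real (symmetry \<tau>) * \<gamma> \<nu> j \<tau> h * h ^ num_nodes \<tau>"
  have comb: "(\<lambda>h. norm (\<Sum>\<nu>\<in>UNIV. \<Sum>j\<in>UNIV. \<beta> \<nu> j h *\<^sub>R
      (h *\<^sub>R e \<nu> j h - (\<Sum>\<tau>\<in>NT q. ?c \<nu> j \<tau> h *\<^sub>R E \<tau>)))) \<in> O[at_right 0](\<lambda>h. 1 * r h)"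
    by (intro norm_sum_bigo norm_scaleR_bigo \<beta> e)
  have eq: "\<forall>\<^sub>F h in at_right 0. (\<Sum>\<nu>\<in>UNIV. \<Sum>j\<in>UNIV. \<beta> \<nu> j h *\<^sub>R
      (h *\<^sub>R e \<nu> j h - (\<Sum>\<tau>\<in>NT q. ?c \<nu> j \<tau> h *\<^sub>R E \<tau>))) = y h - (y0 + (\<Sum>\<tau>\<in>NT q.
       (1 / real (symmetry \<tau>) * (\<Sum>\<nu>\<in>UNIV. \<Sum>j\<in>UNIV. \<beta> \<nu> j h * \<gamma> \<nu> j \<tau> h) * h ^ num_nodes \<tau>)
         *\<^sub>R E \<tau>))"
    using y
  proof eventually_elim
    case (elim h)
    have "(\<Sum>\<tau>\<in>NT q. (1 / real (symmetry \<tau>) * (\<Sum>\<nu>\<in>UNIV. \<Sum>j\<in>UNIV. \<beta> \<nu> j h * \<gamma> \<nu> j \<tau> h) *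
        h ^ num_nodes \<tau>) *\<^sub>R E \<tau>) =
      (\<Sum>\<tau>\<in>NT q. \<Sum>\<nu>\<in>UNIV. \<Sum>j\<in>UNIV. (\<beta> \<nu> j h * ?c \<nu> j \<tau> h) *\<^sub>R E \<tau>)"
      by (intro sum.cong refl)
         (simp add: sum_distrib_left sum_distrib_right scaleR_left.sum[symmetric] mult_ac)
    also have "\<dots> = (\<Sum>\<nu>\<in>UNIV. \<Sum>\<tau>\<in>NT q. \<Sum>j\<in>UNIV. (\<beta> \<nu> j h * ?c \<nu> j \<tau> h) *\<^sub>R E \<tau>)"
      by (rule sum.swap)
    also have "\<dots> = (\<Sum>\<nu>\<in>UNIV. \<Sum>j\<in>UNIV. \<Sum>\<tau>\<in>NT q. (\<beta> \<nu> j h * ?c \<nu> j \<tau> h) *\<^sub>R E \<tau>)"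
      by (intro sum.cong refl sum.swap)
    finally have series: "(\<Sum>\<tau>\<in>NT q. (1 / real (symmetry \<tau>) *
        (\<Sum>\<nu>\<in>UNIV. \<Sum>j\<in>UNIV. \<beta> \<nu> j h * \<gamma> \<nu> j \<tau> h) * h ^ num_nodes \<tau>) *\<^sub>R E \<tau>) = \<dots>" .
    \<comment> \<open>The method sums over stages outside and colors inside, the weights the other
      way round.\<close>
    have y': "y h - y0 = (\<Sum>\<nu>\<in>UNIV. \<Sum>j\<in>UNIV. \<beta> \<nu> j h *\<^sub>R h *\<^sub>R e \<nu> j h)"
      unfolding elim by (subst sum.swap) (simp add: scaleR_right.sum mult_ac)
    show ?case
      unfolding diff_diff_eq[symmetric] series y'
      by (simp add: scaleR_diff_right sum_subtractf scaleR_right.sum)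
  qed
  show ?thesis
    by (rule norm_bigo_cong[OF eq comb[unfolded mult_1]])
qed

section \<open>The expansions of a step, by induction on the order\<close>

theorem theorem5:
  fixes F :: "'n::finite \<Rightarrow> real ^ 'd::finite \<Rightarrow> real ^ 'd"
    and a :: "'n \<Rightarrow> 's::finite \<Rightarrow> 's \<Rightarrow> ('d, 's) stages \<Rightarrow> real \<Rightarrow> real"
    and b :: "'n \<Rightarrow> 's \<Rightarrow> ('d, 's) stages \<Rightarrow> real \<Rightarrow> real"
    and k :: nat
    and yn :: "real ^ 'd"
    and ystage :: "real \<Rightarrow> 's \<Rightarrow> real ^ 'd"
    and ynext :: "real \<Rightarrow> real ^ 'd"
    and Y :: "real \<Rightarrow> ('d, 's) stages"
  defines "Y \<equiv> \<lambda>h. (yn, ystage h, ynext h)"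
  assumes "\<And>\<nu>. C_diff (k + 1) (F \<nu>)"
    and "\<And>\<nu>. \<exists>L. L-lipschitz_on UNIV (F \<nu>)"
    and "\<forall>\<^sub>F h in at_right 0. nsark_step a b F h (Y h)"
    and "\<And>\<nu> i j. (\<lambda>h. a \<nu> i j (Y h) h) \<in> O[at_right 0](\<lambda>h. 1)"
    and "\<And>\<nu> j. (\<lambda>h. b \<nu> j (Y h) h) \<in> O[at_right 0](\<lambda>h. 1)"
  shows "(\<forall>i. (\<lambda>h. norm (ystage h i - (yn + (\<Sum>\<tau>\<in>NT k.
             (1 / real (symmetry \<tau>) * nsark_d a i \<tau> (Y h) h * h ^ num_nodes \<tau>)
               *\<^sub>R elem_diff F \<tau> yn)))) \<in> O[at_right 0](\<lambda>h. h ^ (k + 1))) \<and>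
         (\<forall>i \<nu>. (\<lambda>h. norm (h *\<^sub>R F \<nu> (ystage h i) - (\<Sum>\<tau>\<in>NT k.
             (1 / real (symmetry \<tau>) * nsark_g a \<nu> i \<tau> (Y h) h * h ^ num_nodes \<tau>)
               *\<^sub>R elem_diff F \<tau> yn))) \<in> O[at_right 0](\<lambda>h. h ^ (k + 1))) \<and>
         (\<lambda>h. norm (ynext h - (yn + (\<Sum>\<tau>\<in>NT k.
             (1 / real (symmetry \<tau>) * nsark_u a b \<tau> (Y h) h * h ^ num_nodes \<tau>)
               *\<^sub>R elem_diff F \<tau> yn)))) \<in> O[at_right 0](\<lambda>h. h ^ (k + 1))"
proof -
  note smooth = assms(2) and lip = assms(3) and a = assms(5) and b = assms(6)
  let ?G = "\<lambda>q. \<forall>i \<nu>. (\<lambda>h. norm (h *\<^sub>R F \<nu> (ystage h i) - (\<Sum>\<tau>\<in>NT q.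
             (1 / real (symmetry \<tau>) * nsark_g a \<nu> i \<tau> (Y h) h * h ^ num_nodes \<tau>)
               *\<^sub>R elem_diff F \<tau> yn))) \<in> O[at_right 0](\<lambda>h. h ^ (q + 1))"
  have stage: "\<forall>\<^sub>F h in at_right 0. \<forall>i. ystage h i =
      yn + h *\<^sub>R (\<Sum>j\<in>UNIV. \<Sum>\<nu>\<in>UNIV. a \<nu> i j (Y h) h *\<^sub>R F \<nu> (ystage h j))"
    and "next": "\<forall>\<^sub>F h in at_right 0. ynext h =
      yn + h *\<^sub>R (\<Sum>j\<in>UNIV. \<Sum>\<nu>\<in>UNIV. b \<nu> j (Y h) h *\<^sub>R F \<nu> (ystage h j))"
    using assms(4) unfolding nsark_step_def Y_def prod.case eventually_conj_iff by blast+
  \<comment> \<open>The stage expansion follows from \<open>?G\<close> at the same order, so only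
    \<open>?G\<close> is carried through the induction.\<close>
  have stages: "(\<lambda>h. norm (ystage h i - (yn + (\<Sum>\<tau>\<in>NT q.
             (1 / real (symmetry \<tau>) * nsark_d a i \<tau> (Y h) h * h ^ num_nodes \<tau>)
               *\<^sub>R elem_diff F \<tau> yn)))) \<in> O[at_right 0](\<lambda>h. h ^ (q + 1))" if "?G q" for q i
    unfolding nsark_d.simps
  proof (rule series_linear_combination_bigo[where e = "\<lambda>\<nu> j h. F \<nu> (ystage h j)" and
        \<gamma> = "\<lambda>\<nu> j \<tau> h. nsark_g a \<nu> j \<tau> (Y h) h" and \<beta> = "\<lambda>\<nu> j h. a \<nu> i j (Y h) h"])
    show "\<forall>\<^sub>F h in at_right 0. ystage h i =
      yn + h *\<^sub>R (\<Sum>j\<in>UNIV. \<Sum>\<nu>\<in>UNIV. a \<nu> i j (Y h) h *\<^sub>R F \<nu> (ystage h j))"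
      using stage by (rule eventually_mono) blast
  qed (use that a in blast)+
  have "q \<le> k \<Longrightarrow> ?G q" for q
  proof (induction q)
    case 0
    \<comment> \<open>At order zero the series is empty, and the claim reduces to boundedness of the
      vector fields at the stages.\<close>
    have NT_0: "NT 0 = ({} :: 'n ctree set)"
      using num_nodes_pos by (auto simp: NT_def)
    have "(\<lambda>h. norm (h *\<^sub>R F \<nu> (ystage h i))) \<in> O[at_right 0](\<lambda>h. h * 1)" for \<nu> i
      by (intro norm_scaleR_bigo landau_o.big_refl F_stages_bigo_1[OF lip stage a])
    then show ?case by (simp add: NT_0)
  next
    case (Suc q)
    show ?case
    proof (intro allI)
      fix i \<nu>
      have "C_diff (Suc q) (F \<nu>)"
        using Suc.prems by (intro C_diff_mono[OF smooth]) simp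
      \<comment> \<open>The induction hypothesis, passed through \<open>stages\<close>, expands the
        displacement from \<open>yn\<close> that is inserted into the Taylor polynomial at
        \<open>yn\<close>.\<close>
      moreover have "(\<lambda>h. norm ((ystage h i - yn) - (\<Sum>\<tau>\<in>NT q.
           (1 / real (symmetry \<tau>) * nsark_d a i \<tau> (Y h) h * h ^ num_nodes \<tau>)
             *\<^sub>R elem_diff F \<tau> yn))) \<in> O[at_right 0](\<lambda>h. h ^ Suc q)"
        using stages[of q i] Suc by (simp add: diff_diff_eq)
      ultimately show "(\<lambda>h. norm (h *\<^sub>R F \<nu> (ystage h i) - (\<Sum>\<tau>\<in>NT (Suc q).
             (1 / real (symmetry \<tau>) * nsark_g a \<nu> i \<tau> (Y h) h * h ^ num_nodes \<tau>)
               *\<^sub>R elem_diff F \<tau> yn))) \<in> O[at_right 0](\<lambda>h. h ^ (Suc q + 1))"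
        using series_compose_bigo[of q F \<nu> "\<lambda>\<tau> h. nsark_d a i \<tau> (Y h) h"
            "\<lambda>\<tau> h. nsark_g a \<nu> i \<tau> (Y h) h" "\<lambda>h. ystage h i - yn" yn]
          nsark_weights_bigo_1(2)[where a = a and Y = Y, OF a]
        by simp
    qed
  qed
  then have G: "?G k" by simp
  have "(\<lambda>h. norm (ynext h - (yn + (\<Sum>\<tau>\<in>NT k.
             (1 / real (symmetry \<tau>) * nsark_u a b \<tau> (Y h) h * h ^ num_nodes \<tau>)
               *\<^sub>R elem_diff F \<tau> yn)))) \<in> O[at_right 0](\<lambda>h. h ^ (k + 1))"
    unfolding nsark_u_def
    by (rule series_linear_combination_bigo[where e = "\<lambda>\<nu> j h. F \<nu> (ystage h j)" and
          \<gamma> = "\<lambda>\<nu> j \<tau> h. nsark_g a \<nu> j \<tau> (Y h) h" and \<beta> = "\<lambda>\<nu> j h. b \<nu> j (Y h) h",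
          OF _ b "next"])
       (use G in blast)
  then show ?thesis
    by (intro conjI allI stages[OF G] G[rule_format])
qed

end
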